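(* Let $I_p, I_d$ be fixed $n\times n$ real symmetric positive definite matrices, and suppose that the pair $\mathbf{P}$, $\mathbf{D}$ is asymptotically pd-feasible. Let $\alpha\ge 0$, $\beta\ge 0$ with $(\alpha,\beta)\neq(0,0)$. Then $\lim_{t\downarrow 0} v(t\alpha,t\beta)$ exists (the limit being allowed to be $+\infty$ or $-\infty$).
   Context: Let $\mathcal{S}^n$ be the space of $n\times n$ real symmetric matrices with $U\bullet V=\sum_{i,j} U_{ij}V_{ij}$, and let $\mathcal{S}^n_+$ be the cone of positive semidefinite matrices; $U\succeq 0$ (resp. $U\succ 0$) means $U$ is positive semidefinite (resp. positive definite). Data: $C,A_1,\dots,A_m\in\mathcal{S}^n$, $b\in\mathbb{R}^m$. Problems: $\mathbf{P}$: $\min_X\ C\bullet X$ s.t. $A_i\bullet X=b_i$ ($i=1,\dots,m$), $X\succeq 0$; $\mathbf{D}$: $\max_{y,S}\ b^Ty$ s.t. $C-\sum_i A_iy_i=S$, $S\succeq 0$. Optimal values are infima/suprema in $[-\infty,+\infty]$ (not necessarily attained); an infeasible minimization problem has value $+\infty$ and an infeasible maximization problem has value $-\infty$. Let $\mathcal{V}=\{X\in\mathcal{S}^n: A_i\bullet X=b_i,\ i=1,\dots,m\}$. $\mathbf{P}$ is weakly infeasible if $\mathcal{V}\cap\mathcal{S}^n_+=\emptyset$ but $0$ belongs to the closure of $\mathcal{S}^n_+-\mathcal{V}$. $\mathbf{P}$ is asymptotically feasible if it is feasible or weakly infeasible. The same notions for $\mathbf{D}$ are obtained by replacing $\mathcal{V}$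 by $\{S\in\mathcal{S}^n:\exists y\in\mathbb{R}^m,\ S=C-\sum_iA_iy_i\}$. The pair is asymptotically pd-feasible if both $\mathbf{P}$ and $\mathbf{D}$ are asymptotically feasible. For $\varepsilon,\eta\ge 0$ the perturbed problems are $\mathbf{P}(\varepsilon,\eta)$: $\min\ (C+\varepsilon I_d)\bullet X$ s.t. $A_i\bullet X=b_i+\eta A_i\bullet I_p$ ($i=1,\dots,m$), $X\succeq 0$; $\mathbf{D}(\varepsilon,\eta)$: $\max\ \sum_i(b_i+\eta A_i\bullet I_p)y_i$ s.t. $C-\sum_iA_iy_i+\varepsilon I_d=S$, $S\succeq 0$. $v(\varepsilon,\eta)\in[-\infty,+\infty]$ denotes the common optimal value of $\mathbf{P}(\varepsilon,\eta)$ and $\mathbf{D}(\varepsilon,\eta)$ when the two optimal values coincide, and is undefined otherwise. Under asymptotic pd-feasibility it is defined for all $(\varepsilon,\eta)\ge 0$ with $(\varepsilon,\eta)\ne(0,0)$. *)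

theory Defs
  imports "HOL-Analysis.Analysis"
begin

(* The product U . V = (sum over i, j of U_ij V_ij) is the library inner product on
   real^'n^'n (inner_vec_def); the norm it induces gives the topology used for closures. *)

definition sym_mats :: "(real^'n^'n) set" where
  "sym_mats = {U. transpose U = U}"

definition psd_cone :: "(real^'n^'n) set" where
  "psd_cone = {U \<in> sym_mats. \<forall>x. 0 \<le> x \<bullet> (U *v x)}"

definition pos_def :: "real^'n^'n \<Rightarrow> bool" where
  "pos_def U \<longleftrightarrow> U \<in> sym_mats \<and> (\<forall>x. x \<noteq> 0 \<longrightarrow> 0 < x \<bullet> (U *v x))"

definition primal_space :: "('m::finite \<Rightarrow> real^'n^'n) \<Rightarrow> real^'m \<Rightarrow> (real^'n^'n) set" where
  "primal_space A b = {X \<in> sym_mats. \<forall>i. A i \<bullet> X = b $ i}"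

definition dual_slack ::
    "real^'n^'n \<Rightarrow> ('m::finite \<Rightarrow> real^'n^'n) \<Rightarrow> real^'m \<Rightarrow> real^'n^'n" where
  "dual_slack C A y = C - (\<Sum>i\<in>UNIV. y $ i *\<^sub>R A i)"

definition dual_space :: "real^'n^'n \<Rightarrow> ('m::finite \<Rightarrow> real^'n^'n) \<Rightarrow> (real^'n^'n) set" where
  "dual_space C A = {S \<in> sym_mats. \<exists>y. S = dual_slack C A y}"

(* The second conjunct uses the Minkowski difference of the cone and V, not set difference. *)
definition weakly_infeasible :: "(real^'n^'n) set \<Rightarrow> bool" where
  "weakly_infeasible V \<longleftrightarrow>
     V \<inter> psd_cone = {} \<and> 0 \<in> closure {U - X | U X. U \<in> psd_cone \<and> X \<in> V}"

definition asymptotically_feasible :: "(real^'n^'n) set \<Rightarrow> bool" where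
  "asymptotically_feasible V \<longleftrightarrow> V \<inter> psd_cone \<noteq> {} \<or> weakly_infeasible V"

definition asymptotically_pd_feasible ::
    "real^'n^'n \<Rightarrow> ('m::finite \<Rightarrow> real^'n^'n) \<Rightarrow> real^'m \<Rightarrow> bool" where
  "asymptotically_pd_feasible C A b \<longleftrightarrow>
     asymptotically_feasible (primal_space A b) \<and> asymptotically_feasible (dual_space C A)"

(* In ereal, Inf {} = \<infinity> and Sup {} = -\<infinity>, as required for infeasible problems. *)
definition primal_value ::
    "real^'n^'n \<Rightarrow> ('m::finite \<Rightarrow> real^'n^'n) \<Rightarrow> real^'m \<Rightarrow> ereal" where
  "primal_value C A b = (INF X\<in>primal_space A b \<inter> psd_cone. ereal (C \<bullet> X))"

definition dual_value ::
    "real^'n^'n \<Rightarrow> ('m::finite \<Rightarrow> real^'n^'n) \<Rightarrow> real^'m \<Rightarrow> ereal" where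
  "dual_value C A b = (SUP y\<in>{y. dual_slack C A y \<in> psd_cone}. ereal (b \<bullet> y))"

definition perturbed_cost :: "real^'n^'n \<Rightarrow> real^'n^'n \<Rightarrow> real \<Rightarrow> real^'n^'n" where
  "perturbed_cost C Jd \<epsilon> = C + \<epsilon> *\<^sub>R Jd"

definition perturbed_rhs ::
    "('m::finite \<Rightarrow> real^'n^'n) \<Rightarrow> real^'m \<Rightarrow> real^'n^'n \<Rightarrow> real \<Rightarrow> real^'m" where
  "perturbed_rhs A b Jp \<eta> = (\<chi> i. b $ i + \<eta> * (A i \<bullet> Jp))"

(* v(\<epsilon>, \<eta>); None where the primal and dual optimal values differ. *)
definition common_value ::
    "real^'n^'n \<Rightarrow> ('m::finite \<Rightarrow> real^'n^'n) \<Rightarrow> real^'m \<Rightarrow> real^'n^'n \<Rightarrow> real^'n^'n \<Rightarrow>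
     real \<Rightarrow> real \<Rightarrow> ereal option" where
  "common_value C A b Jp Jd \<epsilon> \<eta> =
     (let p = primal_value (perturbed_cost C Jd \<epsilon>) A (perturbed_rhs A b Jp \<eta>);
          d = dual_value (perturbed_cost C Jd \<epsilon>) A (perturbed_rhs A b Jp \<eta>)
      in if p = d then Some p else None)"

end

(*
  If alpha = 0 or beta = 0, then v(t alpha, t beta), up to a linear term, is monotone in t.

  If both are positive, then P(t alpha, t beta) and D(t alpha, t beta) are strictly feasible for every
  t > 0, so the value V(t) is finite, equal on both sides and continuous in t.  It is moreover an
  algebraic function of t: writing X = Z Z^T, the value is the limit as s tends to 0 of m(t,s) / s,
  where m(t,s) is the minimum over all n x n matrices Z of
    s C_t . Z Z^T + sum_l (A_l . Z Z^T - b_{t,l})^2 + s^2 sum_{ij} Z_ij^6.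
  At a minimiser the gradient vanishes, which rewrites s^2 Z_ij^5 as a polynomial of lower degree in Z.
  Hence, up to powers of s, all powers of the penalty lie in the span of finitely many monomials over
  R[t,s], and a linear dependence among them is a nontrivial polynomial relation between t, s and
  m(t,s); dividing by the maximal power of s and letting s tend to 0 gives one between t and V(t).
  So all but finitely many real numbers are attained by V only finitely often, and a continuous
  function with this property cannot oscillate at 0.
*)
theory Submission
  imports Defs "HOL-Computational_Algebra.Polynomial"
begin

text \<open>Raising the cost raises the value, whereas moving the right-hand side along
  \<open>Jp\<close> lowers it up to a linear term. With both parameters positive the two effects
  compete, so monotonicity says nothing and algebraicity takes its place. The penalty is shaped by
  degree. Squared residuals are quartic in Z with a cubic gradient, and six is the smallest even
  power whose derivative has degree above three; hence the critical equations can be solved for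
  \<open>Z $ i $ j ^ 5\<close> whatever the data, however degenerate the problem or non-unique its
  solutions. The factor s^2 makes the contribution of this term to m(t,s) / s vanish in the limit.
  Only minimal values matter, not the behaviour of minimisers: feasible points of the two problems
  bound m(t,s) / s from below and from above, and strong duality closes the gap. Coefficients are
  kept in the domain R[t,s] so that one relation serves all t and s at once.\<close>

section \<open>Elimination over an integral domain\<close>

text \<open>Gaussian elimination without division: cross-multiplying with a pivot stays inside the
  domain, and the absence of zero divisors keeps the resulting dependence nontrivial.\<close>

lemma idom_linear_dependence:
  fixes u :: "'j \<Rightarrow> 'e \<Rightarrow> 'c::idom"
  assumes "finite E" "finite J" "card E < card J"
  shows "\<exists>l. (\<exists>j\<in>J. l j \<noteq> 0) \<and> (\<forall>e\<in>E. (\<Sum>j\<in>J. l j * u j e) = 0)"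
  using assms
proof (induction E arbitrary: J u rule: finite_induct)
  case empty
  then have "J \<noteq> {}" by auto
  then show ?case by (intro exI[of _ "\<lambda>_. 1"]) auto
next
  case (insert e E)
  show ?case
  proof (cases "\<forall>j\<in>J. u j e = 0")
    case True
    have "card E < card J" using insert by auto
    from insert.IH[OF insert.prems(1) this, of u] True show ?thesis by auto
  next
    case False
    then obtain i where i: "i \<in> J" "u i e \<noteq> 0" by auto
    define J' where "J' = J - {i}"
    have J': "finite J'" "card E < card J'" "i \<notin> J'" "J = insert i J'"
      using insert i by (auto simp: J'_def)
    \<comment> \<open>These vectors vanish at \<open>e\<close>, so one coordinate and the pivot
      vector drop out together.\<close>
    define u' where "u' j e' = u i e * u j e' - u j e * u i e'" for j e'
    obtain l where l: "\<exists>j\<in>J'. l j \<noteq> 0" "\<And>e'. e' \<in> E \<Longrightarrow> (\<Sum>j\<in>J'. l j * u' j e') = 0"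
      using insert.IH[OF J'(1,2), of u'] by auto
    \<comment> \<open>The dependence of the \<open>u'\<close> expanded in the \<open>u\<close>: the
      pivot collects all the subtracted multiples.\<close>
    define l' where "l' j = (if j = i then - (\<Sum>j\<in>J'. l j * u j e) else l j * u i e)" for j
    have split: "(\<Sum>j\<in>J. l' j * u j e')
        = - (\<Sum>j\<in>J'. l j * u j e) * u i e' + (\<Sum>j\<in>J'. l j * u i e * u j e')" for e'
    proof -
      have "(\<Sum>j\<in>J'. l' j * u j e') = (\<Sum>j\<in>J'. l j * u i e * u j e')"
        using J'(3) by (intro sum.cong) (auto simp: l'_def)
      then show ?thesis using J' by (simp add: l'_def)
    qed
    have "(\<Sum>j\<in>J. l' j * u j e') = 0" if "e' \<in> insert e E" for e'
    proof (cases "e' = e")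
      case True
      then show ?thesis unfolding split by (simp add: sum_distrib_right sum_distrib_left algebra_simps)
    next
      case False
      with that have "(\<Sum>j\<in>J'. l j * u' j e') = 0" using l by auto
      then show ?thesis unfolding split u'_def
        by (simp add: sum_distrib_right sum_distrib_left algebra_simps sum_subtractf)
    qed
    moreover obtain j where "j \<in> J'" "l j \<noteq> 0" using l(1) by auto
    then have "j \<in> J" "l' j \<noteq> 0" using J' i by (auto simp: l'_def)
    ultimately show ?thesis by blast
  qed
qed

text \<open>
  Polynomial functions in the coordinates \<open>z w k\<close> whose coefficients are evaluated elements of a
  domain.  The relations \<open>lead\<close> allow, after multiplication by \<open>s\<close>, to replace every fifth power
  by a polynomial of lower degree, so that up to powers of \<open>s\<close> all polynomials lie in the span of
  the finitely many monomials with exponents below five.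
\<close>

locale elimination =
  fixes W :: "'w set" and z :: "'w \<Rightarrow> 'k::finite \<Rightarrow> real" and ev :: "'c::idom \<Rightarrow> 'w \<Rightarrow> real"
    and s :: 'c
  assumes ev_add: "ev (a + b) w = ev a w + ev b w"
    and ev_mult: "ev (a * b) w = ev a w * ev b w"
    and ev_1: "ev 1 w = 1"
begin

definition mon :: "('k \<Rightarrow> nat) \<Rightarrow> 'w \<Rightarrow> real" where
  "mon a w = (\<Prod>k\<in>UNIV. z w k ^ a k)"

text \<open>The degree counts the coordinates \<open>z\<close> alone; a factor \<open>ev c\<close>
  costs nothing, whatever \<open>c\<close> is.\<close>

inductive zpoly :: "nat \<Rightarrow> ('w \<Rightarrow> real) \<Rightarrow> bool" where
  mon: "sum a UNIV \<le> d \<Longrightarrow> zpoly d (mon a)"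
| add: "zpoly d f \<Longrightarrow> zpoly d g \<Longrightarrow> zpoly d (\<lambda>w. f w + g w)"
| scale: "zpoly d f \<Longrightarrow> zpoly d (\<lambda>w. ev c w * f w)"

lemma ev_0: "ev 0 w = 0"
  using ev_add[of 0 0 w] by simp

lemma ev_power: "ev (a ^ n) w = ev a w ^ n"
  by (induction n) (auto simp: ev_1 ev_mult)

lemma ev_sum: "ev (sum f F) w = (\<Sum>x\<in>F. ev (f x) w)"
  by (induction F rule: infinite_finite_induct) (auto simp: ev_0 ev_add)

lemma zpoly_ev: "zpoly d (ev c)"
proof -
  have "mon (\<lambda>_. 0) = (\<lambda>_. 1)" by (auto simp: mon_def)
  with zpoly.scale[OF zpoly.mon[of "\<lambda>_. 0" d], of c] show ?thesis by simp
qed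

lemma zpoly_coord: "0 < d \<Longrightarrow> zpoly d (\<lambda>w. z w k)"
proof -
  assume "0 < d"
  have "mon (\<lambda>k'. if k' = k then 1 else 0) = (\<lambda>w. z w k)"
    by (auto simp: mon_def if_distrib[where f = "power _"] prod.delta cong: if_cong)
  with zpoly.mon[of "\<lambda>k'. if k' = k then 1 else 0" d] \<open>0 < d\<close> show ?thesis by simp
qed

lemma zpoly_mono: "zpoly d f \<Longrightarrow> d \<le> e \<Longrightarrow> zpoly e f"
  by (induction rule: zpoly.induct) (auto intro: zpoly.intros)

lemma zpoly_sum: "(\<And>i. i \<in> I \<Longrightarrow> zpoly d (f i)) \<Longrightarrow> zpoly d (\<lambda>w. \<Sum>i\<in>I. f i w)"
proof (induction I rule: infinite_finite_induct)
  case (insert x F)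
  then show ?case by (auto intro: zpoly.add)
qed (use zpoly_ev[of d 0] in \<open>simp_all add: ev_0[abs_def]\<close>)

lemma mon_mult: "mon a w * mon b w = mon (\<lambda>k. a k + b k) w"
  by (simp add: mon_def prod.distrib power_add)

lemma zpoly_mult: 
  assumes "zpoly d f" "zpoly e g" shows "zpoly (d + e) (\<lambda>w. f w * g w)"
  using assms
proof (induction rule: zpoly.induct)
  case (mon a d)
  show ?case using mon(2,1)
  proof (induction rule: zpoly.induct)
    case (mon b e)
    then show ?case unfolding mon_mult by (intro zpoly.mon) (simp add: sum.distrib)
  next
    case (add e f g)
    then show ?case by (auto simp: algebra_simps intro: zpoly.add)
  next
    case (scale e f c)
    then show ?case using zpoly.scale[of "d+e" "\<lambda>w. mon a w * f w" c] by (simp add: ac_simps)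
  qed
next
  case (add d f g)
  then show ?case by (auto simp: algebra_simps intro: zpoly.add)
next
  case (scale d f c)
  then show ?case using zpoly.scale[of "d+e" "\<lambda>w. f w * g w" c] by (simp add: ac_simps)
qed

lemma zpoly_power: "zpoly d f \<Longrightarrow> zpoly (n * d) (\<lambda>w. f w ^ n)"
proof (induction n)
  case 0
  then show ?case using zpoly_ev[of 0 1] by (simp add: ev_1[abs_def])
next
  case (Suc n)
  then show ?case using zpoly_mult[of d f "n*d" "\<lambda>w. f w ^ n"] by simp
qed

definition low_exponents :: "('k \<Rightarrow> nat) set" where
  "low_exponents = (UNIV \<rightarrow>\<^sub>E {..<5})"

lemma finite_low_exponents: "finite low_exponents"
  unfolding low_exponents_def by (auto intro: finite_PiE)

text \<open>Membership in the span of the low monomials once \<open>s\<close> is inverted. One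
  \<open>N\<close> and one \<open>c\<close> must serve every point of \<open>W\<close>; otherwise no
  dependence common to all points could be extracted.\<close>

definition reducible :: "('w \<Rightarrow> real) \<Rightarrow> bool" where
  "reducible f \<longleftrightarrow> (\<exists>N c. \<forall>w\<in>W. ev s w ^ N * f w = (\<Sum>e\<in>low_exponents. ev (c e) w * mon e w))"

lemma reducible_add: 
  assumes "reducible f" "reducible g" shows "reducible (\<lambda>w. f w + g w)"
proof -
  obtain N c where f: "\<And>w. w \<in> W \<Longrightarrow> ev s w ^ N * f w = (\<Sum>e\<in>low_exponents. ev (c e) w * mon e w)"
    using assms(1) unfolding reducible_def by blast
  obtain M d where g: "\<And>w. w \<in> W \<Longrightarrow> ev s w ^ M * g w = (\<Sum>e\<in>low_exponents. ev (d e) w * mon e w)"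
    using assms(2) unfolding reducible_def by blast
  have "ev s w ^ (N + M) * (f w + g w)
      = (\<Sum>e\<in>low_exponents. ev (s ^ M * c e + s ^ N * d e) w * mon e w)" if w: "w \<in> W" for w
  proof -
    have "ev s w ^ (N + M) * (f w + g w)
        = ev s w ^ M * (ev s w ^ N * f w) + ev s w ^ N * (ev s w ^ M * g w)"
      by (simp add: power_add algebra_simps)
    also have "\<dots> = (\<Sum>e\<in>low_exponents. ev (s ^ M * c e + s ^ N * d e) w * mon e w)"
      unfolding f[OF w] g[OF w]
      by (simp add: ev_add ev_mult ev_power sum_distrib_left sum.distrib algebra_simps)
    finally show ?thesis .
  qed
  then show ?thesis unfolding reducible_def
    by (intro exI[of _ "N + M"] exI[of _ "\<lambda>e. s ^ M * c e + s ^ N * d e"]) blast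
qed

lemma reducible_scale:
  assumes "reducible f" shows "reducible (\<lambda>w. ev c w * f w)"
proof -
  obtain N d where f: "\<And>w. w \<in> W \<Longrightarrow> ev s w ^ N * f w = (\<Sum>e\<in>low_exponents. ev (d e) w * mon e w)"
    using assms(1) unfolding reducible_def by blast
  have "ev s w ^ N * (ev c w * f w) = (\<Sum>e\<in>low_exponents. ev (c * d e) w * mon e w)" if w: "w \<in> W" for w
  proof -
    have "ev s w ^ N * (ev c w * f w) = ev c w * (ev s w ^ N * f w)" by simp
    then show ?thesis unfolding f[OF w] by (simp add: ev_mult sum_distrib_left algebra_simps)
  qed
  then show ?thesis unfolding reducible_def
    by (intro exI[of _ "N"] exI[of _ "\<lambda>e. c * d e"]) blast
qed

lemma reducible_lead:
  assumes "reducible g" and "\<And>w. w \<in> W \<Longrightarrow> ev s w * f w = g w" shows "reducible f"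
proof -
  obtain N d where f: "\<And>w. w \<in> W \<Longrightarrow> ev s w ^ N * g w = (\<Sum>e\<in>low_exponents. ev (d e) w * mon e w)"
    using assms(1) unfolding reducible_def by blast
  have "ev s w ^ Suc N * f w = (\<Sum>e\<in>low_exponents. ev (d e) w * mon e w)" if w: "w \<in> W" for w
    using f[OF w] unfolding assms(2)[OF w, symmetric] by (simp add: mult.assoc mult.left_commute)
  then show ?thesis unfolding reducible_def by blast
qed

text \<open>Each replacement trades five degrees for at most four at the cost of one factor
  \<open>s\<close>, so induction on the degree terminates. The inner induction leaves only single
  monomials to treat.\<close>

lemma zpoly_reducible:
  assumes lead: "\<And>k. \<exists>h. zpoly 4 h \<and> (\<forall>w\<in>W. ev s w * z w k ^ 5 = h w)"
  shows "zpoly d f \<Longrightarrow> reducible f"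
proof (induction d arbitrary: f rule: less_induct)
  case (less d)
  from less(2,1) show ?case
  proof (induction rule: zpoly.induct)
    case (mon a d)
    show ?case
    proof (cases "a \<in> low_exponents")
      case True
      have "ev s w ^ 0 * mon a w = (\<Sum>e\<in>low_exponents. ev (if e = a then 1 else 0) w * mon e w)" for w
        using True finite_low_exponents
        by (simp add: if_distrib[where f = "\<lambda>x. ev x w * _"] ev_0 ev_1 sum.delta cong: if_cong)
      then show ?thesis unfolding reducible_def
    by (intro exI[of _ "0"] exI[of _ "\<lambda>e. if e = a then 1 else 0"]) blast
    next
      case False
      then obtain k where k: "5 \<le> a k" unfolding low_exponents_def
        by (auto simp: PiE_iff not_less)
      define a' where "a' = a(k := a k - 5)"
      have S: "sum a UNIV = a k + sum a (UNIV - {k})" "sum a' UNIV = a' k + sum a' (UNIV - {k})"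
        by (simp_all add: sum.remove)
      have "sum a' (UNIV - {k}) = sum a (UNIV - {k})"
        by (intro sum.cong) (auto simp: a'_def)
      with S k have deg: "5 + sum a' UNIV = sum a UNIV" by (simp add: a'_def)
      have "mon a w = z w k ^ 5 * mon a' w" for w
      proof -
        have "mon a w = z w k ^ a k * (\<Prod>j\<in>UNIV-{k}. z w j ^ a j)"
          "mon a' w = z w k ^ a' k * (\<Prod>j\<in>UNIV-{k}. z w j ^ a' j)"
          unfolding mon_def by (simp_all add: prod.remove)
        moreover have "(\<Prod>j\<in>UNIV-{k}. z w j ^ a' j) = (\<Prod>j\<in>UNIV-{k}. z w j ^ a j)"
          by (intro prod.cong) (auto simp: a'_def)
        moreover have "z w k ^ a k = z w k ^ 5 * z w k ^ a' k"
          using k by (simp add: a'_def flip: power_add)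
        ultimately show ?thesis by simp
      qed
      moreover obtain h where h: "zpoly 4 h" "\<And>w. w \<in> W \<Longrightarrow> ev s w * z w k ^ 5 = h w"
        using lead by blast
      ultimately have "ev s w * mon a w = h w * mon a' w" if "w \<in> W" for w
        using that by (simp add: ac_simps)
      moreover have "zpoly (4 + sum a' UNIV) (\<lambda>w. h w * mon a' w)"
        by (intro zpoly_mult h zpoly.mon) auto
      \<comment> \<open>\<open>mon(2)\<close> is the outer hypothesis for smaller degrees; it
        applies because 4 replaces 5 in \<open>deg\<close>.\<close>
      then have "reducible (\<lambda>w. h w * mon a' w)"
        using mon(2)[of "4 + sum a' UNIV"] deg mon(1) by simp
      ultimately show ?thesis by (rule reducible_lead[rotated])
    qed
  qed (auto intro: reducible_add reducible_scale)
qed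

text \<open>The \<open>D + 1\<close> powers of \<open>g\<close> up to exponent \<open>D\<close> are,
  up to powers of \<open>s\<close>, combinations of \<open>D\<close> monomials, so their coefficient
  vectors are linearly dependent over the domain, independently of the point.\<close>

lemma algebraic_relation:
  assumes lead: "\<And>k. \<exists>h. zpoly 4 h \<and> (\<forall>w\<in>W. ev s w * z w k ^ 5 = h w)"
    and nz: "\<And>w. w \<in> W \<Longrightarrow> ev s w \<noteq> 0"
    and g: "zpoly d g"
  shows "\<exists>D l. (\<exists>j\<le>D::nat. l j \<noteq> 0) \<and> (\<forall>w\<in>W. (\<Sum>j\<le>D. ev (l j) w * g w ^ j) = 0)"
proof -
  define D where "D = card low_exponents"
  have "reducible (\<lambda>w. g w ^ j)" for j
    using zpoly_reducible[OF lead zpoly_power[OF g]] .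
  then obtain N c where c: "\<And>j w. w \<in> W \<Longrightarrow>
      ev s w ^ N j * g w ^ j = (\<Sum>e\<in>low_exponents. ev (c j e) w * mon e w)"
    unfolding reducible_def by metis
  obtain l where l: "\<exists>j\<in>{..D}. l j \<noteq> 0" "\<And>e. e \<in> low_exponents \<Longrightarrow> (\<Sum>j\<in>{..D}. l j * c j e) = 0"
    using idom_linear_dependence[OF finite_low_exponents, of "{..D}" c] by (auto simp: D_def)
  have rel: "(\<Sum>j\<le>D. ev (l j * s ^ N j) w * g w ^ j) = 0" if w: "w \<in> W" for w
  proof -
    have "(\<Sum>j\<le>D. ev (l j * s ^ N j) w * g w ^ j) = (\<Sum>j\<le>D. ev (l j) w * (ev s w ^ N j * g w ^ j))"
      by (simp add: ev_mult ev_power ac_simps)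
    also have "\<dots> = (\<Sum>j\<le>D. \<Sum>e\<in>low_exponents. ev (l j * c j e) w * mon e w)"
      unfolding c[OF w] by (simp add: sum_distrib_left ev_mult mult.assoc)
    also have "\<dots> = (\<Sum>e\<in>low_exponents. \<Sum>j\<le>D. ev (l j * c j e) w * mon e w)"
      by (rule sum.swap)
    also have "\<dots> = (\<Sum>e\<in>low_exponents. ev (\<Sum>j\<le>D. l j * c j e) w * mon e w)"
      by (simp add: sum_distrib_right ev_sum)
    also have "\<dots> = 0" using l(2) by (simp add: ev_0)
    finally show ?thesis .
  qed
  obtain j where j: "j \<le> D" "l j \<noteq> 0" using l(1) by auto
  show ?thesis
  proof (cases "W = {}")
    case True
    then show ?thesis by (intro exI[of _ 0] exI[of _ "\<lambda>_. 1"]) auto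
  next
    case False
    then obtain w where "w \<in> W" by auto
    with nz ev_0 have "s \<noteq> 0" by metis
    then have "l j * s ^ N j \<noteq> 0" using j by auto
    then show ?thesis using rel j(1)
      by (intro exI[of _ D] exI[of _ "\<lambda>j. l j * s ^ N j"]) blast
  qed
qed

end

section \<open>Limits of algebraic functions\<close>

text \<open>Substituting a constant \<open>c\<close> for \<open>v t\<close> leaves a polynomial in
  \<open>t\<close>. Its coefficient at a suitable \<open>i\<close> is a nonzero polynomial
  \<open>q\<close> in \<open>c\<close>, so only the roots of \<open>q\<close> can have infinite
  fibres. Exceptions do occur: a constant \<open>v\<close> has one.\<close>

lemma finite_fibres_of_algebraic:
  fixes v :: "real \<Rightarrow> real" and g :: "nat \<Rightarrow> real poly"
  assumes nz: "\<exists>j\<le>D. g j \<noteq> 0"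
    and rel: "\<And>t. t > 0 \<Longrightarrow> (\<Sum>j\<le>D. poly (g j) t * v t ^ j) = 0"
  shows "\<exists>F. finite F \<and> (\<forall>c. c \<notin> F \<longrightarrow> finite {t. 0 < t \<and> v t = c})"
proof -
  obtain j0 where j0: "j0 \<le> D" "g j0 \<noteq> 0" using nz by auto
  then obtain i where i: "coeff (g j0) i \<noteq> 0" by (metis leading_coeff_0_iff)
  define q where "q = (\<Sum>j\<le>D. monom (coeff (g j) i) j)"
  have "coeff q j0 = coeff (g j0) i" using j0
    by (simp add: q_def coeff_sum if_distrib sum.delta cong: if_cong)
  with i have "q \<noteq> 0" by auto
  have "finite {t. 0 < t \<and> v t = c}" if c: "c \<notin> {c. poly q c = 0}" for c
  proof -
    define p where "p = (\<Sum>j\<le>D. smult (c ^ j) (g j))"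
    have "coeff p i = poly q c"
      by (simp add: p_def q_def coeff_sum poly_sum poly_monom ac_simps)
    with c have "p \<noteq> 0" by auto
    moreover have "{t. 0 < t \<and> v t = c} \<subseteq> {t. poly p t = 0}"
      using rel by (auto simp: p_def poly_sum ac_simps)
    ultimately show ?thesis using poly_roots_finite finite_subset by blast
  qed
  with poly_roots_finite[OF \<open>q \<noteq> 0\<close>] show ?thesis by blast
qed

text \<open>Oscillation would cross every level between the lower and the upper limit. A level
  outside \<open>F\<close> is not attained near 0, so by the intermediate value theorem
  \<open>v\<close> stays on one side of it there.\<close>

lemma limit_at_right_if_finite_fibres:
  fixes v :: "real \<Rightarrow> real"
  assumes cont: "continuous_on {0<..} v"
    and F: "finite F" "\<And>c. c \<notin> F \<Longrightarrow> finite {t. 0 < t \<and> v t = c}"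
  shows "\<exists>L. ((\<lambda>t. ereal (v t)) \<longlongrightarrow> L) (at_right 0)"
proof -
  let ?f = "\<lambda>t. ereal (v t)"
  let ?l = "Liminf (at_right 0) ?f" and ?L = "Limsup (at_right 0) ?f"
  have "?l = ?L"
  proof (rule antisym)
    show "?l \<le> ?L" by (intro Liminf_le_Limsup) simp
    show "?L \<le> ?l"
    proof (rule ccontr)
      assume "\<not> ?L \<le> ?l"
      then obtain a where a: "?l < ereal a" "ereal a < ?L" using ereal_dense2[of ?l ?L] by (auto simp: not_le)
      then obtain b where b: "ereal a < ereal b" "ereal b < ?L" using ereal_dense2[of a ?L] by auto
      then have "infinite {a<..<b}" by simp
      with F(1) obtain c where c: "c \<in> {a<..<b}" "c \<notin> F"
        by (meson finite_subset subsetI)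
      \<comment> \<open>The element 1 keeps the set nonempty, so that \<open>Min\<close> makes sense
        even if \<open>c\<close> is never attained.\<close>
      have fin: "finite (insert 1 {t. 0 < t \<and> v t = c})" (is "finite ?T") using F c by simp
      define d where "d = Min ?T"
      have d0: "d > 0" and "\<And>t. t \<in> ?T \<Longrightarrow> d \<le> t"
        unfolding d_def using fin by (auto simp del: Min_insert intro!: Min_le)
      then have ne: "v t \<noteq> c" if "0 < t" "t < d" for t using that by force
      have ev: "eventually (\<lambda>t. t \<in> {0<..<d}) (at_right 0)"
        using eventually_at_right_real[OF d0] .
      have "connected (v ` {0<..<d})"
        by (intro connected_continuous_image continuous_on_subset[OF cont]) auto
      moreover have "c \<notin> v ` {0<..<d}" using ne by fastforce
      ultimately have "(\<forall>t\<in>{0<..<d}. v t \<le> c) \<or> (\<forall>t\<in>{0<..<d}. c \<le> v t)"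
        unfolding connected_iff_interval by (meson imageI linear)
      then show False
      proof
        assume "\<forall>t\<in>{0<..<d}. v t \<le> c"
        then have "?L \<le> c" by (intro Limsup_bounded eventually_mono[OF ev]) auto
        also have "ereal c < ereal b" using c by auto
        finally show False using b by simp
      next
        assume "\<forall>t\<in>{0<..<d}. c \<le> v t"
        then have "c \<le> ?l" by (intro Liminf_bounded eventually_mono[OF ev]) auto
        moreover have "ereal a < ereal c" using c by auto
        ultimately show False using a by (meson less_le_trans not_less_iff_gr_or_eq)
      qed
    qed
  qed
  then have "(?f \<longlongrightarrow> ?L) (at_right 0)" by (intro Liminf_eq_Limsup) auto
  then show ?thesis by blast
qed

text \<open>Dividing out the largest common power of the outer variable before setting it to zero
  keeps the limiting relation nontrivial.\<close>

lemma algebraic_relation_limit: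
  fixes l :: "nat \<Rightarrow> real poly poly" and v :: "real \<Rightarrow> real" and w :: "real \<Rightarrow> real \<Rightarrow> real"
  assumes nz: "\<exists>j\<le>D. l j \<noteq> 0"
    and rel: "\<And>t s. t > 0 \<Longrightarrow> s > 0 \<Longrightarrow> (\<Sum>j\<le>D. poly (poly (l j) [:s:]) t * w t s ^ j) = 0"
    and lim: "\<And>t. t > 0 \<Longrightarrow> (w t \<longlongrightarrow> v t) (at_right 0)"
  shows "\<exists>g. (\<exists>j\<le>D. g j \<noteq> 0) \<and> (\<forall>t>0. (\<Sum>j\<le>D. poly (g j) t * v t ^ j) = 0)"
proof -
  define k where "k = (LEAST k. \<exists>j\<le>D. coeff (l j) k \<noteq> 0)"
  obtain j0 where "j0 \<le> D" "l j0 \<noteq> 0" using nz by blast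
  then have "\<exists>k. \<exists>j\<le>D. coeff (l j) k \<noteq> 0"
    by (intro exI[of _ "degree (l j0)"] exI[of _ j0]) simp
  then have k: "\<exists>j\<le>D. coeff (l j) k \<noteq> 0" unfolding k_def by (rule LeastI_ex)
  have below: "coeff (l j) i = 0" if "i < k" "j \<le> D" for i j
    using not_less_Least[OF that(1)[unfolded k_def]] that(2) by blast
  define m where "m j = poly_shift k (l j)" for j
  have m: "l j = monom 1 k * m j" if "j \<le> D" for j
    using below[OF _ that] by (intro poly_eqI) (auto simp: coeff_monom_mult coeff_poly_shift m_def)
  have rel': "(\<Sum>j\<le>D. poly (poly (m j) [:s:]) t * w t s ^ j) = 0" if "t > 0" "s > 0" for s t
  proof -
    have "s ^ k * (\<Sum>j\<le>D. poly (poly (m j) [:s:]) t * w t s ^ j) = (\<Sum>j\<le>D. poly (poly (l j) [:s:]) t * w t s ^ j)"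
      by (simp add: sum_distrib_left m poly_monom poly_const_pow mult.assoc)
    also have "\<dots> = 0" using rel that by blast
    finally show ?thesis using that by simp
  qed
  have "(\<Sum>j\<le>D. poly (coeff (m j) 0) t * v t ^ j) = 0" if t: "t > 0" for t
  proof -
    \<comment> \<open>The outer variable is \<open>s\<close> and the inner one is \<open>t\<close>;
      at \<open>s = 0\<close> only the constant outer coefficient survives.\<close>
    have pc: "((\<lambda>s. poly (poly p [:s:]) t) \<longlongrightarrow> poly (coeff p 0) t) (at_right 0)" for p :: "real poly poly"
    proof -
      have "((\<lambda>s. poly (poly p [:s:]) t) \<longlongrightarrow> poly (poly p 0) t) (at_right 0)"
      proof (induction p)
        case (pCons a p)
        have "((\<lambda>s. poly a t + s * poly (poly p [:s:]) t) \<longlongrightarrow> poly a t + 0 * poly (poly p 0) t) (at_right 0)"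
          by (intro tendsto_intros pCons)
        then show ?case by simp
      qed simp
      then show ?thesis by (simp add: poly_0_coeff_0)
    qed
    have "((\<lambda>s. \<Sum>j\<le>D. poly (poly (m j) [:s:]) t * w t s ^ j) \<longlongrightarrow>
        (\<Sum>j\<le>D. poly (coeff (m j) 0) t * v t ^ j)) (at_right 0)"
      by (intro tendsto_intros pc lim t)
    moreover have "((\<lambda>s. \<Sum>j\<le>D. poly (poly (m j) [:s:]) t * w t s ^ j) \<longlongrightarrow> 0) (at_right 0)"
      by (rule tendsto_eventually, rule eventually_at_rightI[of 0 1]) (simp_all add: rel' t)
    ultimately show ?thesis using tendsto_unique trivial_limit_at_right_real by blast
  qed
  moreover have "\<exists>j\<le>D. coeff (m j) 0 \<noteq> 0" using k by (auto simp: m_def coeff_poly_shift)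
  ultimately show ?thesis by (intro exI[of _ "\<lambda>j. coeff (m j) 0"]) simp
qed

section \<open>The cone of positive semidefinite matrices\<close>

text \<open>The rank-one matrix x y^T. Quadratic forms become inner products with it, so the cone is
  cut out by linear functionals.\<close>

definition outer :: "real^'n \<Rightarrow> real^'n \<Rightarrow> real^'n^'n" where
  "outer x y = (\<chi> i j. x $ i * y $ j)"

lemma inner_matrix_vector: "x \<bullet> (U *v y) = U \<bullet> outer x y"
  by (simp add: inner_vec_def matrix_vector_mult_def outer_def sum_distrib_left ac_simps)

lemma norm_outer: "norm (outer x y) = norm x * norm y"
proof -
  have "outer x y \<bullet> outer x y = (x \<bullet> x) * (y \<bullet> y)"
    by (simp add: inner_vec_def outer_def sum_product ac_simps)
  then show ?thesis by (simp add: norm_eq_sqrt_inner real_sqrt_mult)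
qed

lemma sym_mats_iff: "U \<in> sym_mats \<longleftrightarrow> (\<forall>i j. U $ i $ j = U $ j $ i)"
  unfolding sym_mats_def transpose_def by (auto simp: vec_eq_iff)

lemma subspace_sym_mats: "subspace (sym_mats :: (real^'n^'n) set)"
  unfolding subspace_def by (auto simp: sym_mats_iff)

lemmas sym_mats_add = subspace_add[OF subspace_sym_mats]
  and sym_mats_scale = subspace_mul[OF subspace_sym_mats]
  and sym_mats_diff = subspace_diff[OF subspace_sym_mats]

lemma outer_sym: "outer x x \<in> sym_mats"
  by (simp add: sym_mats_iff outer_def mult.commute)

lemma psd_coneI: "U \<in> sym_mats \<Longrightarrow> (\<And>x. 0 \<le> U \<bullet> outer x x) \<Longrightarrow> U \<in> psd_cone"
  by (simp add: psd_cone_def inner_matrix_vector)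

lemma psd_coneD: "U \<in> psd_cone \<Longrightarrow> U \<in> sym_mats" "U \<in> psd_cone \<Longrightarrow> 0 \<le> U \<bullet> outer x x"
  by (simp_all add: psd_cone_def inner_matrix_vector)

lemma psd_zero: "0 \<in> psd_cone"
  using subspace_0[OF subspace_sym_mats] by (intro psd_coneI) auto

lemma psd_add: "U \<in> psd_cone \<Longrightarrow> V \<in> psd_cone \<Longrightarrow> U + V \<in> psd_cone"
  by (intro psd_coneI sym_mats_add) (auto simp: psd_coneD inner_add_left)

lemma psd_scale: "U \<in> psd_cone \<Longrightarrow> 0 \<le> c \<Longrightarrow> c *\<^sub>R U \<in> psd_cone"
  by (intro psd_coneI sym_mats_scale) (auto simp: psd_coneD)

lemma outer_psd: "outer x x \<in> psd_cone"
proof (intro psd_coneI outer_sym)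
  fix y
  have "outer x x \<bullet> outer y y = (x \<bullet> y) * (x \<bullet> y)"
    by (simp add: inner_vec_def outer_def sum_product ac_simps)
  then show "0 \<le> outer x x \<bullet> outer y y" by simp
qed

lemma pos_def_psd: "pos_def U \<Longrightarrow> U \<in> psd_cone"
  unfolding pos_def_def psd_cone_def by (auto simp: less_imp_le) (metis inner_zero_left order_less_le order_refl)

lemma gram_eq_sum_outer: "Z ** transpose Z = (\<Sum>j\<in>UNIV. outer (column j Z) (column j Z))"
  by (simp add: vec_eq_iff matrix_matrix_mult_def transpose_def outer_def column_def)

lemma outer_axis_inner: "U \<bullet> outer (axis i a) (axis j b) = a * b * U $ i $ j"
proof -
  have "U \<bullet> outer (axis i a) (axis j b) = axis i a \<bullet> (U *v axis j b)"
    by (simp add: inner_matrix_vector)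
  also have "\<dots> = a * b * U $ i $ j"
    by (simp add: inner_axis' matrix_vector_mult_def)
      (simp add: axis_def if_distrib cong: if_cong)
  finally show ?thesis .
qed

lemma outer_add_left: "outer (x + y) z = outer x z + outer y z"
  and outer_add_right: "outer z (x + y) = outer z x + outer z y"
  and outer_scale_left: "outer (c *\<^sub>R x) z = c *\<^sub>R outer x z"
  and outer_scale_right: "outer z (c *\<^sub>R x) = c *\<^sub>R outer z x"
  by (simp_all add: outer_def vec_eq_iff algebra_simps)

lemma sym_inner_outer_commute: "U \<in> sym_mats \<Longrightarrow> U \<bullet> outer x y = U \<bullet> outer y x"
  unfolding inner_vec_def outer_def sym_mats_iff
  by (subst sum.swap) (simp add: inner_vec_def ac_simps)

lemma psd_diag_nonneg: "U \<in> psd_cone \<Longrightarrow> 0 \<le> U $ i $ i"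
  using psd_coneD(2)[of U "axis i 1"] by (simp add: outer_axis_inner)

lemma psd_quadratic:
  assumes "U \<in> psd_cone"
  shows "0 \<le> U \<bullet> outer x x + 2 * c * (U \<bullet> outer x y) + c\<^sup>2 * (U \<bullet> outer y y)"
proof -
  have "0 \<le> U \<bullet> outer (x + c *\<^sub>R y) (x + c *\<^sub>R y)" using assms by (rule psd_coneD)
  also have "\<dots> = U \<bullet> outer x x + 2 * c * (U \<bullet> outer x y) + c\<^sup>2 * (U \<bullet> outer y y)"
    using sym_inner_outer_commute[OF psd_coneD(1)[OF assms], of y x]
    by (simp add: outer_add_left outer_add_right outer_scale_left outer_scale_right
        inner_add_right power2_eq_square algebra_simps)
  finally show ?thesis .
qed

lemma psd_zero_diag_row:
  assumes U: "U \<in> psd_cone" and 0: "U $ i $ i = 0"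
  shows "U $ i $ j = 0"
proof (rule ccontr)
  assume ne: "U $ i $ j \<noteq> 0"
  \<comment> \<open>With a vanishing diagonal entry the form is affine in \<open>c\<close>; this
    choice gives it the value -1.\<close>
  let ?c = "- (U $ j $ j + 1) / (2 * U $ j $ i)"
  have "U $ j $ i \<noteq> 0" using ne psd_coneD(1)[OF U] by (simp add: sym_mats_iff)
  then have "U $ j $ j + 2 * ?c * U $ j $ i = - 1" by (simp add: field_simps)
  moreover have "0 \<le> U $ j $ j + 2 * ?c * U $ j $ i"
    using psd_quadratic[OF U, of "axis j 1" ?c "axis i 1"] 0 by (simp add: outer_axis_inner)
  ultimately show False by simp
qed

text \<open>Cholesky elimination: subtracting the outer square of a normalised column clears one diagonal
  entry.  If that entry is already zero, division by zero makes the subtracted matrix zero.\<close>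

lemma psd_sum_outer:
  assumes "finite I" "X \<in> psd_cone" "\<And>j. j \<notin> I \<Longrightarrow> X $ j $ j = 0"
  shows "\<exists>z. X = (\<Sum>i\<in>I. outer (z i) (z i))"
  using assms
proof (induction I arbitrary: X rule: finite_induct)
  case empty
  have "X = 0" using psd_zero_diag_row[OF empty(1)] empty(2) by (simp add: vec_eq_iff)
  then show ?case by simp
next
  case (insert i I)
  let ?a = "X $ i $ i"
  define x where "x = (1 / sqrt ?a) *\<^sub>R (X *v axis i 1)"
  define Y where "Y = X - outer x x"
  have a: "0 \<le> ?a" by (rule psd_diag_nonneg) fact
  have Xsym: "X \<in> sym_mats" by (rule psd_coneD) fact
  have xk: "x $ k = X $ k $ i / sqrt ?a" for k
    by (simp add: x_def matrix_vector_mult_def axis_def if_distrib cong: if_cong)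
  have Y: "Y \<in> psd_cone"
  proof (rule psd_coneI)
    show "Y \<in> sym_mats" unfolding Y_def using Xsym outer_sym by (rule sym_mats_diff)
    fix y
    have 1: "outer x x \<bullet> outer y y = (x \<bullet> y)\<^sup>2"
      by (simp add: inner_vec_def outer_def sum_product power2_eq_square ac_simps)
    have 2: "x \<bullet> y = (X \<bullet> outer y (axis i 1)) / sqrt ?a"
      by (simp add: x_def inner_commute flip: inner_matrix_vector)
    \<comment> \<open>Cauchy-Schwarz for the form of \<open>X\<close>, obtained by inserting the
      minimiser of the quadratic in \<open>c\<close>.\<close>
    have "0 \<le> X \<bullet> outer y y - (X \<bullet> outer y (axis i 1))\<^sup>2 / ?a"
    proof (cases "?a = 0")
      case True
      then show ?thesis using psd_coneD(2)[OF insert.prems(1)] by simp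
    next
      case False
      then show ?thesis
        using psd_quadratic[OF insert.prems(1), of y "- (X \<bullet> outer y (axis i 1)) / ?a" "axis i 1"]
        by (simp add: outer_axis_inner power2_eq_square field_simps)
    qed
    then show "0 \<le> Y \<bullet> outer y y"
      using a by (simp add: Y_def inner_diff_left 1 2 power_divide)
  qed
  moreover have "Y $ j $ j = 0" if "j \<notin> I" for j
  proof (cases "j = i")
    case True
    then show ?thesis using a by (auto simp: Y_def outer_def xk real_div_sqrt)
  next
    case False
    \<comment> \<open>Here \<open>Y $ j $ j\<close> is minus a square, and also nonnegative because
      \<open>Y\<close> is in the cone.\<close>
    then have "X $ j $ j = 0" using that insert.prems by auto
    with psd_diag_nonneg[OF Y, of j] show ?thesis by (auto simp: Y_def outer_def not_less mult_le_0_iff intro!: antisym)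
  qed
  ultimately obtain z where z: "Y = (\<Sum>k\<in>I. outer (z k) (z k))" using insert.IH by blast
  have "X = outer x x + (\<Sum>k\<in>I. outer (z k) (z k))" using z by (simp add: Y_def algebra_simps)
  also have "\<dots> = (\<Sum>k\<in>insert i I. outer ((z(i := x)) k) ((z(i := x)) k))"
    using insert.hyps by (auto intro!: sum.cong)
  finally show ?case by blast
qed

text \<open>The elimination yields one vector per index; taken as columns they form a square matrix,
  so the penalty needs only square \<open>Z\<close>.\<close>

lemma psd_eq_gram:
  fixes X :: "real^'n^'n"
  assumes "X \<in> psd_cone" shows "\<exists>Z :: real^'n^'n. X = Z ** transpose Z"
proof -
  obtain z :: "'n \<Rightarrow> real^'n" where z: "X = (\<Sum>i\<in>UNIV. outer (z i) (z i))"
    using psd_sum_outer[OF finite assms, of UNIV] by auto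
  have "column j (\<chi> i j. z j $ i) = z j" for j by (simp add: column_def vec_eq_iff)
  then show ?thesis unfolding gram_eq_sum_outer using z
    by (intro exI[of _ "\<chi> i j. z j $ i"]) simp
qed

lemma inner_gram_nonneg: "U \<in> psd_cone \<Longrightarrow> 0 \<le> U \<bullet> (Z ** transpose Z)"
  unfolding gram_eq_sum_outer inner_sum_right by (intro sum_nonneg psd_coneD)

lemma psd_inner_nonneg: "U \<in> psd_cone \<Longrightarrow> V \<in> psd_cone \<Longrightarrow> 0 \<le> U \<bullet> V"
  using psd_eq_gram inner_gram_nonneg by metis

section \<open>Positive definite matrices as interior points of the cone\<close>

text \<open>\<open>d\<close> is the minimum of the form on the unit sphere, that is, the smallest
  eigenvalue; a symmetric perturbation of smaller norm cannot cancel it.\<close>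

lemma pos_def_perturb:
  assumes "pos_def U"
  shows "\<exists>d>0. \<forall>E\<in>sym_mats. norm E < d \<longrightarrow> pos_def (U + E)"
proof -
  let ?S = "sphere (0 :: real^'n) 1"
  have "continuous_on ?S (\<lambda>x. x \<bullet> (U *v x))"
    by (intro continuous_intros matrix_vector_mult_linear_continuous_on)
  moreover have "axis undefined 1 \<in> ?S" by simp
  then have "?S \<noteq> {}" by blast
  ultimately obtain x0 where x0: "x0 \<in> ?S" "\<And>x. x \<in> ?S \<Longrightarrow> x0 \<bullet> (U *v x0) \<le> x \<bullet> (U *v x)"
    using continuous_attains_inf[OF compact_sphere] by blast
  define d where "d = x0 \<bullet> (U *v x0)"
  have "x0 \<noteq> 0" using x0 by auto
  then have d: "d > 0" using assms by (auto simp: d_def pos_def_def)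
  have "pos_def (U + E)" if E: "E \<in> sym_mats" "norm E < d" for E
  proof -
    have "0 < x \<bullet> ((U + E) *v x)" if "x \<noteq> 0" for x
    proof -
      have "(1 / norm x) *\<^sub>R x \<in> ?S" using that by simp
      from x0(2)[OF this] have "d \<le> (1 / norm x)\<^sup>2 * (U \<bullet> outer x x)"
        unfolding d_def by (simp add: inner_matrix_vector outer_scale_left outer_scale_right power2_eq_square)
      then have "d * (norm x)\<^sup>2 \<le> U \<bullet> outer x x" using that by (simp add: field_simps)
      moreover have "\<bar>E \<bullet> outer x x\<bar> \<le> norm E * (norm x)\<^sup>2"
        using Cauchy_Schwarz_ineq2[of E "outer x x"] by (simp add: norm_outer power2_eq_square)
      moreover have "norm E * (norm x)\<^sup>2 < d * (norm x)\<^sup>2" using E that by simp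
      ultimately show ?thesis by (simp add: inner_matrix_vector inner_add_left)
    qed
    then show ?thesis using E assms sym_mats_add by (auto simp: pos_def_def)
  qed
  with d show ?thesis by blast
qed

lemma pos_def_add_psd: "pos_def U \<Longrightarrow> V \<in> psd_cone \<Longrightarrow> pos_def (U + V)"
  unfolding pos_def_def psd_cone_def
  by (auto simp: sym_mats_add matrix_vector_mult_add_rdistrib inner_add_right intro: add_pos_nonneg)

lemma pos_def_scale: "pos_def U \<Longrightarrow> 0 < c \<Longrightarrow> pos_def (c *\<^sub>R U)"
  unfolding pos_def_def by (auto simp: sym_mats_scale inner_matrix_vector)

text \<open>A small step from \<open>U\<close> in direction \<open>- V\<close> stays in the cone,
  hence still has a nonnegative product with \<open>V\<close>.\<close>

lemma pos_def_inner_pos: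
  assumes U: "pos_def U" and V: "V \<in> psd_cone" "V \<noteq> 0"
  shows "0 < U \<bullet> V"
proof -
  obtain d where d: "d > 0" "\<And>E. E \<in> sym_mats \<Longrightarrow> norm E < d \<Longrightarrow> pos_def (U + E)"
    using pos_def_perturb[OF U] by blast
  define c where "c = d / (2 * norm V)"
  have c: "c > 0" using d V by (simp add: c_def)
  have "norm (- c *\<^sub>R V) < d" using V d c by (simp add: c_def)
  then have "pos_def (U + (- c) *\<^sub>R V)" using d(2) sym_mats_scale psd_coneD(1) V by metis
  then have "0 \<le> (U + (- c) *\<^sub>R V) \<bullet> V" using psd_inner_nonneg V pos_def_psd by metis
  then have "c * (V \<bullet> V) \<le> U \<bullet> V" by (simp add: inner_diff_left)
  moreover have "0 < c * (V \<bullet> V)" using c V by simp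
  ultimately show ?thesis by simp
qed

section \<open>Strong duality under strict feasibility\<close>

lemma dual_slack_inner: "dual_slack C A y \<bullet> X = C \<bullet> X - (\<Sum>i\<in>UNIV. y $ i * (A i \<bullet> X))"
  by (simp add: dual_slack_def inner_diff_left inner_sum_left)

lemma dual_slack_primal_inner: "X \<in> primal_space A b \<Longrightarrow> dual_slack C A y \<bullet> X = C \<bullet> X - b \<bullet> y"
proof -
  assume "X \<in> primal_space A b"
  then have "(\<Sum>i\<in>UNIV. y $ i * (A i \<bullet> X)) = b \<bullet> y"
    unfolding inner_vec_def[of b y] by (auto simp: primal_space_def mult.commute intro!: sum.cong)
  then show ?thesis by (simp add: dual_slack_inner)
qed

lemma dual_slack_sym: 
  "C \<in> sym_mats \<Longrightarrow> (\<And>i. A i \<in> sym_mats) \<Longrightarrow> dual_slack C A y \<in> sym_mats"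
  unfolding dual_slack_def
  by (intro sym_mats_diff subspace_sum subspace_sym_mats sym_mats_scale)

lemma weak_duality:
  "X \<in> primal_space A b \<Longrightarrow> X \<in> psd_cone \<Longrightarrow> dual_slack C A y \<in> psd_cone \<Longrightarrow> b \<bullet> y \<le> C \<bullet> X"
  using dual_slack_primal_inner[of X A b C y] psd_inner_nonneg[of "dual_slack C A y" X] by simp

lemma dual_value_le_primal_value: "dual_value C A b \<le> primal_value C A b"
  unfolding primal_value_def dual_value_def
  by (intro INF_greatest SUP_least) (auto intro: weak_duality)

text \<open>Reads off signs from a separating functional along rays.\<close>

lemma nonneg_if_multiples_bounded_below:
  fixes k q :: real
  assumes "\<And>c. c > 0 \<Longrightarrow> k \<le> c * q"
  shows "0 \<le> q"
proof (rule ccontr)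
  assume "\<not> 0 \<le> q"
  define c where "c = (\<bar>k\<bar> + 1) / (- q)"
  have "c > 0" unfolding c_def using \<open>\<not> 0 \<le> q\<close> by (intro divide_pos_pos) auto
  moreover have "c * q = - (\<bar>k\<bar> + 1)" using \<open>\<not> 0 \<le> q\<close> by (simp add: c_def)
  ultimately show False using assms[of c] by linarith
qed

text \<open>The separating functional lies in the span of the separated set, which excludes the
  degenerate case even when the \<open>A i\<close> are linearly dependent.\<close>

lemma strong_duality_primal_strict:
  fixes C :: "real^'n^'n" and A :: "'m::finite \<Rightarrow> real^'n^'n"
  assumes sym: "C \<in> sym_mats" "\<And>i. A i \<in> sym_mats"
    and X0: "X0 \<in> primal_space A b" "pos_def X0"
  shows "primal_value C A b = dual_value C A b"
proof (rule antisym[OF _ dual_value_le_primal_value])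
  have upper: "primal_value C A b \<le> ereal (C \<bullet> X0)"
    unfolding primal_value_def using X0 pos_def_psd by (intro INF_lower) auto
  show "primal_value C A b \<le> dual_value C A b"
  \<comment> \<open>Value minus infinity is trivial, and \<open>upper\<close> excludes plus
    infinity.\<close>
  proof (cases "primal_value C A b")
    case (real p)
    have low: "p \<le> C \<bullet> X" if "X \<in> primal_space A b" "X \<in> psd_cone" for X
    proof -
      have "primal_value C A b \<le> ereal (C \<bullet> X)"
        unfolding primal_value_def using that by (intro INF_lower) auto
      with real show ?thesis by simp
    qed
    define h :: "real^'n^'n \<Rightarrow> real \<times> (real^'m)" where "h X = (C \<bullet> X, \<chi> i. A i \<bullet> X)" for X
    have lin: "linear h"
      by (intro linearI) (auto simp: h_def inner_add_right vec_eq_iff)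
    \<comment> \<open>Pairs of cost excess, lifted by \<open>r\<close>, and residual: 0 in
      \<open>M\<close> would be a feasible matrix of cost \<open>p - r\<close>.\<close>
    define M where "M = {h X + (r - p, - b) | X r. X \<in> psd_cone \<and> r > 0}"
    have "convex M"
      unfolding convex_def
    proof (intro ballI allI impI)
      fix m m' u v :: _ assume "m \<in> M" "m' \<in> M" and uv: "0 \<le> u" "0 \<le> v" "u + v = (1::real)"
      then obtain X r X' r' where m: "X \<in> psd_cone" "r > 0" "m = h X + (r - p, - b)"
        "X' \<in> psd_cone" "r' > 0" "m' = h X' + (r' - p, - b)" unfolding M_def by blast
      have "u *\<^sub>R m + v *\<^sub>R m' = h (u *\<^sub>R X + v *\<^sub>R X') + (u * r + v * r' - (u + v) * p, - (u + v) *\<^sub>R b)"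
        unfolding m linear_add[OF lin] linear_cmul[OF lin] by (simp add: algebra_simps)
      moreover have "u * r + v * r' > 0"
        using m uv by (cases "u = 0") (auto intro: add_pos_nonneg)
      moreover have "u *\<^sub>R X + v *\<^sub>R X' \<in> psd_cone" using m uv by (intro psd_add psd_scale)
      ultimately show "u *\<^sub>R m + v *\<^sub>R m' \<in> M" unfolding M_def using uv by fastforce
    qed
    moreover have "h 0 + (1 - p, - b) \<in> M" unfolding M_def using psd_zero zero_less_one by blast
    then have "M \<noteq> {}" by blast
    moreover have "0 \<notin> M"
    proof
      assume "0 \<in> M"
      then obtain X r where Xr: "X \<in> psd_cone" "r > 0" "C \<bullet> X + r - p = 0" "(\<chi> i. A i \<bullet> X) = b"
        unfolding M_def h_def zero_prod_def by (auto simp: algebra_simps)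
      then have "X \<in> primal_space A b" using psd_coneD by (auto simp: primal_space_def)
      with low Xr show False by fastforce
    qed
    ultimately obtain n where n: "n \<in> span M" "n \<noteq> 0" "\<And>x. x \<in> M \<Longrightarrow> 0 \<le> n \<bullet> x"
      using separating_hyperplane_set_0_inspan by blast
    obtain a0 a where na: "n = (a0, a)" by (cases n)
    define N where "N = (\<Sum>i\<in>UNIV. a $ i *\<^sub>R A i)"
    have inn: "n \<bullet> (h X + (r - p, - b)) = a0 * (C \<bullet> X + r - p) + N \<bullet> X - a \<bullet> b" for X r
      by (simp add: na h_def N_def inner_vec_def[of a] inner_sum_left algebra_simps sum_subtractf)
    have sep: "0 \<le> a0 * (C \<bullet> X + r - p) + N \<bullet> X - a \<bullet> b" if "X \<in> psd_cone" "r > 0" for X r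
      unfolding inn[symmetric] by (rule n(3)) (use that in \<open>auto simp: M_def\<close>)
    have a0: "a0 \<ge> 0"
    proof (rule nonneg_if_multiples_bounded_below)
      fix r :: real assume "r > 0"
      from sep[OF psd_zero this] show "a0 * p + a \<bullet> b \<le> r * a0" by (simp add: algebra_simps)
    qed
    \<comment> \<open>Otherwise a functional that is nonnegative on the cone would vanish at the
      interior point \<open>X0\<close>, forcing \<open>N = 0\<close>; then \<open>n\<close> is
      orthogonal to \<open>M\<close>, hence to itself.\<close>
    have "a0 \<noteq> 0"
    proof
      assume "a0 = 0"
      have *: "0 \<le> N \<bullet> X - a \<bullet> b" if "X \<in> psd_cone" for X
        using sep[OF that zero_less_one] \<open>a0 = 0\<close> by simp
      have NX0: "N \<bullet> X0 = a \<bullet> b"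
        using X0 by (simp add: N_def primal_space_def inner_sum_left inner_vec_def[of a])
      have Nsym: "N \<in> sym_mats" unfolding N_def
        by (intro subspace_sum subspace_sym_mats sym_mats_scale sym)
      have "N = 0"
      proof (rule ccontr)
        assume "N \<noteq> 0"
        obtain d where d: "d > 0" "\<And>E. E \<in> sym_mats \<Longrightarrow> norm E < d \<Longrightarrow> pos_def (X0 + E)"
          using pos_def_perturb[OF X0(2)] by blast
        define c where "c = d / (2 * norm N)"
        have c: "c > 0" using d \<open>N \<noteq> 0\<close> by (simp add: c_def)
        have "norm ((- c) *\<^sub>R N) < d" using \<open>N \<noteq> 0\<close> d c by (simp add: c_def)
        then have "pos_def (X0 + (- c) *\<^sub>R N)" using d(2) sym_mats_scale Nsym by metis
        from *[OF pos_def_psd[OF this]] NX0 have "c * (N \<bullet> N) \<le> 0" by (simp add: inner_diff_right)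
        moreover have "0 < c * (N \<bullet> N)" using c \<open>N \<noteq> 0\<close> by simp
        ultimately show False by simp
      qed
      have "n \<bullet> x = 0" if "x \<in> M" for x
      proof -
        obtain X r where "x = h X + (r - p, - b)" using \<open>x \<in> M\<close> unfolding M_def by blast
        then show ?thesis using inn[of X r] NX0 \<open>N = 0\<close> \<open>a0 = 0\<close> by simp
      qed
      then have "orthogonal n n"
        using orthogonal_to_span[OF n(1), of n] by (auto simp: orthogonal_def inner_commute)
      with n(2) show False by (simp add: orthogonal_def)
    qed
    with a0 have a0: "a0 > 0" by simp
    define y where "y = (- 1 / a0) *\<^sub>R a"
    have slack: "dual_slack C A y \<bullet> X = C \<bullet> X + (N \<bullet> X) / a0" for X
      by (simp add: dual_slack_inner y_def N_def inner_sum_left sum_divide_distrib sum_negf)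
    \<comment> \<open>Along rays in \<open>X\<close> this puts the slack into the cone; at
      \<open>X = 0\<close> with small \<open>r\<close> it bounds the objective.\<close>
    have key: "p - b \<bullet> y - r \<le> dual_slack C A y \<bullet> X" if X: "X \<in> psd_cone" "r > 0" for X r
    proof -
      have "0 \<le> (a0 * (C \<bullet> X + r - p) + N \<bullet> X - a \<bullet> b) / a0" using sep[OF that] a0 by simp
      also have "\<dots> = C \<bullet> X + r - p + (N \<bullet> X) / a0 - (a \<bullet> b) / a0" using a0 by (simp add: field_simps)
      finally show ?thesis unfolding slack by (simp add: y_def inner_commute)
    qed
    have "dual_slack C A y \<in> psd_cone"
    proof (intro psd_coneI dual_slack_sym sym)
      fix x
      show "0 \<le> dual_slack C A y \<bullet> outer x x"
      proof (rule nonneg_if_multiples_bounded_below)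
        fix c :: real assume "c > 0"
        then have "c *\<^sub>R outer x x \<in> psd_cone" by (intro psd_scale outer_psd) simp
        from key[OF this zero_less_one]
        show "p - b \<bullet> y - 1 \<le> c * (dual_slack C A y \<bullet> outer x x)" by simp
      qed
    qed
    moreover have "p \<le> b \<bullet> y"
    proof (rule field_le_epsilon)
      fix e :: real assume "e > 0"
      from key[OF psd_zero this] show "p \<le> b \<bullet> y + e" by simp
    qed
    ultimately have "ereal p \<le> dual_value C A b"
      unfolding dual_value_def by (intro SUP_upper2[of y]) auto
    with real show ?thesis by simp
  qed (use upper in auto)
qed

text \<open>The same separation on the dual side: the negated matrix part of the normal, rescaled,
  is an optimal primal matrix. A normal with \<open>a = 0\<close> is impossible because a nonzero
  matrix of the cone has a positive product with a positive definite slack.\<close>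

lemma strong_duality_dual_strict:
  fixes C :: "real^'n^'n" and A :: "'m::finite \<Rightarrow> real^'n^'n"
  assumes sym: "C \<in> sym_mats" "\<And>i. A i \<in> sym_mats"
    and y0: "pos_def (dual_slack C A y0)"
  shows "primal_value C A b = dual_value C A b"
proof (rule antisym[OF _ dual_value_le_primal_value])
  have lower: "ereal (b \<bullet> y0) \<le> dual_value C A b"
    unfolding dual_value_def using y0 pos_def_psd by (intro SUP_upper) auto
  show "primal_value C A b \<le> dual_value C A b"
  proof (cases "dual_value C A b")
    case (real d)
    have up: "b \<bullet> y \<le> d" if "dual_slack C A y \<in> psd_cone" for y
    proof -
      have "ereal (b \<bullet> y) \<le> dual_value C A b"
        unfolding dual_value_def using that by (intro SUP_upper) auto
      with real show ?thesis by simp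
    qed
    define h :: "real^'m \<Rightarrow> real \<times> (real^'n^'n)" where "h y = (- (b \<bullet> y), dual_slack 0 A y)" for y
    have lin: "linear h"
      by (intro linearI) (auto simp: h_def dual_slack_def inner_add_right algebra_simps sum.distrib scaleR_sum_right)
    have h: "h y = (- (b \<bullet> y), dual_slack C A y - C)" for y by (simp add: h_def dual_slack_def)
    \<comment> \<open>0 in \<open>M\<close> would be a dual feasible \<open>y\<close> with objective
      \<open>d + r\<close>.\<close>
    define M where "M = {h y + (r + d, C - U) | y r U. U \<in> psd_cone \<and> r > 0}"
    have "convex M"
      unfolding convex_def
    proof (intro ballI allI impI)
      fix m m' u v :: _ assume "m \<in> M" "m' \<in> M" and uv: "0 \<le> u" "0 \<le> v" "u + v = (1::real)"
      then obtain y r U y' r' U' where m: "U \<in> psd_cone" "r > 0" "m = h y + (r + d, C - U)"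
        "U' \<in> psd_cone" "r' > 0" "m' = h y' + (r' + d, C - U')" unfolding M_def by blast
      have "u *\<^sub>R m + v *\<^sub>R m' = h (u *\<^sub>R y + v *\<^sub>R y')
          + (u * r + v * r' + (u + v) * d, (u + v) *\<^sub>R C - (u *\<^sub>R U + v *\<^sub>R U'))"
        unfolding m linear_add[OF lin] linear_cmul[OF lin] by (simp add: algebra_simps)
      moreover have "u * r + v * r' > 0"
        using m uv by (cases "u = 0") (auto intro: add_pos_nonneg)
      moreover have "u *\<^sub>R U + v *\<^sub>R U' \<in> psd_cone" using m uv by (intro psd_add psd_scale)
      ultimately show "u *\<^sub>R m + v *\<^sub>R m' \<in> M" unfolding M_def using uv by fastforce
    qed
    moreover have "h 0 + (1 + d, C - 0) \<in> M" unfolding M_def using psd_zero zero_less_one by blast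
    then have "M \<noteq> {}" by blast
    moreover have "0 \<notin> M"
    proof
      assume "0 \<in> M"
      then obtain y r where "dual_slack C A y \<in> psd_cone" "r > 0" "b \<bullet> y = r + d"
        unfolding M_def h zero_prod_def by (auto simp: algebra_simps)
      with up[of y] show False by auto
    qed
    ultimately obtain n where n: "n \<in> span M" "n \<noteq> 0" "\<And>x. x \<in> M \<Longrightarrow> 0 \<le> n \<bullet> x"
      using separating_hyperplane_set_0_inspan by blast
    obtain a X where na: "n = (a, X)" by (cases n)
    \<comment> \<open>Separation alone does not make \<open>X\<close> symmetric; membership of the
      normal in the span of \<open>M\<close> does.\<close>
    have "M \<subseteq> UNIV \<times> sym_mats"
      by (auto simp: M_def h intro: sym_mats_diff dual_slack_sym sym psd_coneD(1))
    then have "span M \<subseteq> UNIV \<times> sym_mats"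
      by (intro span_minimal subspace_Times subspace_UNIV subspace_sym_mats)
    with n(1) na have Xsym: "X \<in> sym_mats" by auto
    have sep: "0 \<le> a * (r + d - b \<bullet> y) + X \<bullet> (dual_slack C A y - U)" if "U \<in> psd_cone" "r > 0" for y U r
    proof -
      have "h y + (r + d, C - U) \<in> M" using that by (auto simp: M_def)
      from n(3)[OF this] show ?thesis by (simp add: na h algebra_simps)
    qed
    have a: "0 \<le> a"
    proof (rule nonneg_if_multiples_bounded_below)
      fix r :: real assume "r > 0"
      from sep[OF psd_zero this, of 0] show "- a * d - X \<bullet> C \<le> r * a"
        by (simp add: dual_slack_def algebra_simps)
    qed
    have "- X \<in> psd_cone"
    proof (rule psd_coneI)
      show "- X \<in> sym_mats" using Xsym by (rule subspace_neg[OF subspace_sym_mats])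
      fix x
      show "0 \<le> - X \<bullet> outer x x"
      proof (rule nonneg_if_multiples_bounded_below)
        fix c :: real assume "c > 0"
        then have "c *\<^sub>R outer x x \<in> psd_cone" by (intro psd_scale outer_psd) simp
        from sep[OF this zero_less_one, of 0]
        show "- a * (1 + d) - X \<bullet> C \<le> c * (- X \<bullet> outer x x)"
          by (simp add: dual_slack_def inner_diff_right algebra_simps)
      qed
    qed
    have "a \<noteq> 0"
    proof
      assume "a = 0"
      with n(2) na have "- X \<noteq> 0" by (simp add: zero_prod_def)
      with pos_def_inner_pos[OF y0 \<open>- X \<in> psd_cone\<close>] sep[OF psd_zero zero_less_one, of y0] \<open>a = 0\<close>
      show False by (simp add: inner_commute)
    qed
    with a have apos: "0 < a" by simp
    define Z where "Z = (1 / a) *\<^sub>R (- X)"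
    have Z: "Z \<in> psd_cone" unfolding Z_def using apos \<open>- X \<in> psd_cone\<close> by (intro psd_scale) auto
    \<comment> \<open>The residual of \<open>Z\<close>. By \<open>key\<close> an affine function of
      the free variable \<open>y\<close> with gradient \<open>g\<close> is bounded above, so
      \<open>g\<close> vanishes.\<close>
    define g where "g = (\<chi> i. b $ i - A i \<bullet> Z)"
    have key: "C \<bullet> Z + y \<bullet> g \<le> d + r" if "r > 0" for y r
    proof -
      have "0 \<le> (a * (r + d - b \<bullet> y) + X \<bullet> (dual_slack C A y - 0)) / a"
        using sep[OF psd_zero that, of y] apos by simp
      also have "\<dots> = r + d - b \<bullet> y - dual_slack C A y \<bullet> Z"
        using apos by (simp add: Z_def add_divide_distrib inner_commute)
      also have "\<dots> = r + d - C \<bullet> Z - y \<bullet> g"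
        by (simp add: dual_slack_inner g_def inner_vec_def[of y] inner_vec_def[of b] algebra_simps sum_subtractf)
      finally show ?thesis by simp
    qed
    have "0 \<le> - (g \<bullet> g)"
    proof (rule nonneg_if_multiples_bounded_below)
      fix c :: real
      from key[OF zero_less_one, of "c *\<^sub>R g"] show "C \<bullet> Z - d - 1 \<le> c * - (g \<bullet> g)" by simp
    qed
    then have "g = 0" using inner_ge_zero[of g] by (metis antisym inner_eq_zero_iff neg_0_le_iff_le)
    then have "Z \<in> primal_space A b"
      using psd_coneD(1)[OF Z] by (auto simp: primal_space_def g_def vec_eq_iff)
    moreover have "C \<bullet> Z \<le> d"
    proof (rule field_le_epsilon)
      fix e :: real assume "e > 0"
      from key[OF this, of 0] show "C \<bullet> Z \<le> d + e" by simp
    qed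
    ultimately have "primal_value C A b \<le> ereal d"
      unfolding primal_value_def using Z by (intro INF_lower2[of Z]) auto
    with real show ?thesis by simp
  qed (use lower in auto)
qed

section \<open>A sextic penalty function\<close>

definition penalty ::
    "real^'n^'n \<Rightarrow> ('m::finite \<Rightarrow> real^'n^'n) \<Rightarrow> real^'m \<Rightarrow> real \<Rightarrow> real^'n^'n \<Rightarrow> real" where
  "penalty C A b s Z = s * (C \<bullet> (Z ** transpose Z))
     + (\<Sum>l\<in>UNIV. (A l \<bullet> (Z ** transpose Z) - b $ l)\<^sup>2)
     + s\<^sup>2 * (\<Sum>i\<in>UNIV. \<Sum>j\<in>UNIV. Z $ i $ j ^ 6)"

text \<open>The derivative of Z Z^T in direction \<open>E\<close>.\<close>

definition gram_deriv :: "real^'n^'n \<Rightarrow> real^'n^'n \<Rightarrow> real^'n^'n" where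
  "gram_deriv Z E = E ** transpose Z + Z ** transpose E"

lemma gram_eq: "(Z :: real^'n^'n) ** transpose Z = (\<chi> i j. \<Sum>k\<in>UNIV. Z $ i $ k * Z $ j $ k)"
  by (simp add: matrix_matrix_mult_def transpose_def)

lemma norm_gram_le: "norm ((Z :: real^'n^'n) ** transpose Z) \<le> Z \<bullet> Z"
proof -
  have "norm (Z ** transpose Z) \<le> (\<Sum>j\<in>UNIV. norm (outer (column j Z) (column j Z)))"
    unfolding gram_eq_sum_outer by (rule norm_sum)
  also have "\<dots> = (\<Sum>j\<in>UNIV. column j Z \<bullet> column j Z)"
    by (simp add: norm_outer norm_eq_square flip: power2_eq_square power2_norm_eq_inner)
  also have "\<dots> = Z \<bullet> Z"
    by (simp add: inner_vec_def column_def) (rule sum.swap)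
  finally show ?thesis .
qed

lemma continuous_penalty: "continuous_on S (penalty C A b s)"
  unfolding penalty_def[abs_def] gram_eq
  by (intro continuous_intros continuous_on_vec_lambda)

lemma sextic_dominates_square:
  fixes s k :: real
  assumes "s > 0" "k \<ge> 0"
  shows "\<exists>L. \<forall>x. x\<^sup>2 - L \<le> s\<^sup>2 * x ^ 6 - k * x\<^sup>2"
proof -
  \<comment> \<open>Ensures \<open>Y \<ge> 1\<close> and \<open>k + 1 \<le> s\<^sup>2 * Y\<close>:
    above this threshold the sextic term wins, below it the constant does.\<close>
  define Y where "Y = 1 + (k + 1) / s\<^sup>2"
  have "x\<^sup>2 - (k + 1) * Y \<le> s\<^sup>2 * x ^ 6 - k * x\<^sup>2" for x
  proof (cases "Y \<le> x\<^sup>2")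
    case True
    have "Y \<ge> 1" using assms by (simp add: Y_def)
    have "k + 1 \<le> s\<^sup>2 * Y" using assms by (simp add: Y_def field_simps)
    also have "\<dots> \<le> s\<^sup>2 * (x\<^sup>2 * x\<^sup>2)"
      using True \<open>Y \<ge> 1\<close> mult_mono[of Y "x\<^sup>2" 1 "x\<^sup>2"] by (intro mult_left_mono) auto
    finally have "(k + 1) * x\<^sup>2 \<le> s\<^sup>2 * (x\<^sup>2 * x\<^sup>2) * x\<^sup>2" by (intro mult_right_mono) auto
    also have "\<dots> = s\<^sup>2 * x ^ 6" by (simp add: power_numeral_reduce)
    moreover have "0 \<le> (k + 1) * Y" using assms \<open>Y \<ge> 1\<close> by simp
    ultimately show ?thesis by (simp add: algebra_simps)
  next
    case False
    then have "(k + 1) * x\<^sup>2 \<le> (k + 1) * Y" using assms by (intro mult_left_mono) auto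
    moreover have "0 \<le> s\<^sup>2 * x ^ 6" by simp
    ultimately show ?thesis by (simp only: distrib_right mult_1)
  qed
  then show ?thesis by blast
qed

text \<open>Only the cost term can be negative, and it is at most quadratic in the entries, so the
  sextic term makes the function coercive and a large ball suffices.\<close>

lemma penalty_attains_min:
  fixes C :: "real^'n^'n" and A :: "'m::finite \<Rightarrow> real^'n^'n"
  assumes s: "s > 0"
  shows "\<exists>Z. \<forall>Y. penalty C A b s Z \<le> penalty C A b s Y"
proof -
  define k where "k = s * norm C"
  have "k \<ge> 0" using s by (simp add: k_def)
  then obtain L where L: "\<And>x. x\<^sup>2 - L \<le> s\<^sup>2 * x ^ 6 - k * x\<^sup>2"
    using sextic_dominates_square[OF s] by blast
  define N where "N = (\<Sum>i\<in>(UNIV::'n set). \<Sum>j\<in>(UNIV::'n set). L)"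
  have coercive: "Z \<bullet> Z - N \<le> penalty C A b s Z" for Z
  proof -
    have "- (norm C * (Z \<bullet> Z)) \<le> C \<bullet> (Z ** transpose Z)"
      using Cauchy_Schwarz_ineq2[of C "Z ** transpose Z"]
        mult_left_mono[OF norm_gram_le[of Z] norm_ge_zero[of C]] by linarith
    then have 1: "- k * (Z \<bullet> Z) \<le> s * (C \<bullet> (Z ** transpose Z))"
      using s mult_left_mono[of "- (norm C * (Z \<bullet> Z))" "C \<bullet> (Z ** transpose Z)" s]
      by (simp add: k_def mult.assoc)
    have 2: "Z \<bullet> Z = (\<Sum>i\<in>UNIV. \<Sum>j\<in>UNIV. (Z $ i $ j)\<^sup>2)"
      by (simp add: inner_vec_def power2_eq_square)
    have "(\<Sum>i\<in>UNIV. \<Sum>j\<in>UNIV. (Z $ i $ j)\<^sup>2 - L)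
        \<le> (\<Sum>i\<in>UNIV. \<Sum>j\<in>UNIV. s\<^sup>2 * (Z $ i $ j) ^ 6 - k * (Z $ i $ j)\<^sup>2)"
      by (intro sum_mono L)
    then have "Z \<bullet> Z - N \<le> s\<^sup>2 * (\<Sum>i\<in>UNIV. \<Sum>j\<in>UNIV. Z $ i $ j ^ 6) - k * (Z \<bullet> Z)"
      unfolding 2 N_def by (simp only: sum_subtractf sum_distrib_left)
    moreover have "0 \<le> (\<Sum>l\<in>UNIV. (A l \<bullet> (Z ** transpose Z) - b $ l)\<^sup>2)"
      by (intro sum_nonneg) auto
    ultimately show ?thesis using 1 unfolding penalty_def by linarith
  qed
  \<comment> \<open>\<open>R \<ge> 1\<close> gives \<open>R * R \<ge> R\<close>, so outside the ball
    the coercive bound exceeds the value at 0.\<close>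
  define R where "R = 1 + \<bar>penalty C A b s 0 + N\<bar>"
  have "\<exists>Z\<in>cball 0 R. \<forall>Y\<in>cball 0 R. penalty C A b s Z \<le> penalty C A b s Y"
    by (rule continuous_attains_inf[OF compact_cball _ continuous_penalty]) (auto simp: R_def)
  then obtain Z where "\<forall>Y\<in>cball 0 R. penalty C A b s Z \<le> penalty C A b s Y" by blast
  then have Z: "\<And>Y. norm Y \<le> R \<Longrightarrow> penalty C A b s Z \<le> penalty C A b s Y" by simp
  have "penalty C A b s Z \<le> penalty C A b s Y" for Y
  proof (cases "norm Y \<le> R")
    case False
    have "penalty C A b s Z \<le> penalty C A b s 0" by (rule Z) (simp add: R_def)
    also have "\<dots> \<le> R * R - N"
    proof -
      have "R \<ge> 1" by (simp add: R_def)
      then have "R * 1 \<le> R * R" by (intro mult_left_mono) auto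
      then show ?thesis by (simp add: R_def)
    qed
    also have "\<dots> \<le> Y \<bullet> Y - N"
      using False mult_mono[of R "norm Y" R "norm Y"]
      by (simp add: R_def flip: power2_norm_eq_inner power2_eq_square)
    also have "\<dots> \<le> penalty C A b s Y" by (rule coercive)
    finally show ?thesis .
  qed (rule Z)
  then show ?thesis by blast
qed

text \<open>Stationarity along a matrix unit, solved for the leading term; the right-hand side is at
  most cubic in \<open>Z\<close>.\<close>

lemma penalty_critical:
  fixes C Z :: "real^'n^'n" and A :: "'m::finite \<Rightarrow> real^'n^'n"
  assumes min: "\<And>Y. penalty C A b s Z \<le> penalty C A b s Y"
  shows "6 * s\<^sup>2 * Z $ i $ j ^ 5 = - (s * (C \<bullet> gram_deriv Z (axis i (axis j 1)))
     + (\<Sum>l\<in>UNIV. 2 * (A l \<bullet> (Z ** transpose Z) - b $ l) * (A l \<bullet> gram_deriv Z (axis i (axis j 1)))))"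
proof -
  define E :: "real^'n^'n" where "E = axis i (axis j 1)"
  define f where "f x = penalty C A b s (Z + x *\<^sub>R E)" for x
  have gram: "(Z + x *\<^sub>R E) ** transpose (Z + x *\<^sub>R E)
      = Z ** transpose Z + x *\<^sub>R gram_deriv Z E + x\<^sup>2 *\<^sub>R (E ** transpose E)" for x
    by (simp add: vec_eq_iff gram_deriv_def matrix_matrix_mult_def transpose_def sum.distrib
        sum_distrib_left algebra_simps power2_eq_square)
  have "(f has_real_derivative (s * (C \<bullet> gram_deriv Z E)
     + (\<Sum>l\<in>UNIV. 2 * (A l \<bullet> (Z ** transpose Z) - b $ l) * (A l \<bullet> gram_deriv Z E))
     + s\<^sup>2 * (\<Sum>i\<in>UNIV. \<Sum>j\<in>UNIV. 6 * Z $ i $ j ^ 5 * E $ i $ j))) (at 0)"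
    unfolding f_def[abs_def] penalty_def gram
    by (auto simp: inner_add_right intro!: derivative_eq_intros sum.cong) (simp add: algebra_simps)
  then have "s * (C \<bullet> gram_deriv Z E)
     + (\<Sum>l\<in>UNIV. 2 * (A l \<bullet> (Z ** transpose Z) - b $ l) * (A l \<bullet> gram_deriv Z E))
     + s\<^sup>2 * (\<Sum>i\<in>UNIV. \<Sum>j\<in>UNIV. 6 * Z $ i $ j ^ 5 * E $ i $ j) = 0"
    by (rule DERIV_local_min[of _ _ _ 1]) (use min in \<open>auto simp: f_def\<close>)
  moreover have "(\<Sum>i'\<in>UNIV. \<Sum>j'\<in>UNIV. 6 * Z $ i' $ j' ^ 5 * E $ i' $ j') = 6 * Z $ i $ j ^ 5"
  proof -
    have "(\<Sum>j'\<in>UNIV. 6 * Z $ i' $ j' ^ 5 * E $ i' $ j') = (if i' = i then 6 * Z $ i $ j ^ 5 else 0)" for i'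
      by (auto simp: E_def axis_def if_distrib cong: if_cong)
    then show ?thesis by simp
  qed
  ultimately show ?thesis unfolding E_def by (simp add: algebra_simps)
qed

text \<open>A dual feasible \<open>y\<close> bounds the quotient from below up to an error linear in
  \<open>s\<close>; a Gram factor of a primal feasible matrix has zero residual and bounds it from
  above with a similar error. Convergence of \<open>Z s\<close> is not claimed.\<close>

lemma penalty_value_tendsto:
  fixes C :: "real^'n^'n" and A :: "'m::finite \<Rightarrow> real^'n^'n"
  assumes p: "primal_value C A b = ereal p" and d: "dual_value C A b = ereal p"
    and Z: "\<And>s Y. s > 0 \<Longrightarrow> penalty C A b s (Z s) \<le> penalty C A b s Y"
  shows "((\<lambda>s. penalty C A b s (Z s) / s) \<longlongrightarrow> p) (at_right 0)"
proof (rule order_tendstoI)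
  have pos: "eventually (\<lambda>s::real. s > 0) (at_right 0)" by (simp add: eventually_at_right_less)
  fix a :: real
  {
    assume "a < p"
    then have "ereal a < dual_value C A b" using d by simp
    then obtain y where y: "dual_slack C A y \<in> psd_cone" "a < b \<bullet> y"
      unfolding dual_value_def less_SUP_iff by auto
    have bound: "b \<bullet> y - s * (y \<bullet> y) / 4 \<le> penalty C A b s (Z s) / s" if s: "s > 0" for s
    proof -
      define X where "X = Z s ** transpose (Z s)"
      define r where "r = (\<chi> l. A l \<bullet> X - b $ l)"
      have "0 \<le> dual_slack C A y \<bullet> X" unfolding X_def by (rule inner_gram_nonneg) fact
      also have "\<dots> = C \<bullet> X - y \<bullet> r - b \<bullet> y"
        by (simp add: dual_slack_inner r_def inner_vec_def[of y] inner_vec_def[of b]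
            algebra_simps sum_subtractf)
      finally have "s * (b \<bullet> y + y \<bullet> r) \<le> s * (C \<bullet> X)"
        using s by (intro mult_left_mono) auto
      \<comment> \<open>Completing the square: the squared residual absorbs the linear term
        \<open>s * (y \<bullet> r)\<close> at a cost of order s^2.\<close>
      moreover have "0 \<le> (r + (s / 2) *\<^sub>R y) \<bullet> (r + (s / 2) *\<^sub>R y)" by simp
      then have "0 \<le> r \<bullet> r + s * (y \<bullet> r) + s\<^sup>2 * (y \<bullet> y) / 4"
        by (simp add: inner_add_left inner_add_right inner_commute power2_eq_square algebra_simps)
      moreover have "r \<bullet> r = (\<Sum>l\<in>UNIV. (A l \<bullet> X - b $ l)\<^sup>2)"
        by (simp add: r_def inner_vec_def[of "vec_lambda _"] power2_eq_square)
      moreover have "0 \<le> s\<^sup>2 * (\<Sum>i\<in>UNIV. \<Sum>j\<in>UNIV. Z s $ i $ j ^ 6)"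
        by (intro mult_nonneg_nonneg sum_nonneg) auto
      ultimately have "s * (b \<bullet> y) - s\<^sup>2 * (y \<bullet> y) / 4 \<le> penalty C A b s (Z s)"
        unfolding penalty_def X_def[symmetric] by (simp add: algebra_simps)
      then have "(s * (b \<bullet> y) - s\<^sup>2 * (y \<bullet> y) / 4) / s \<le> penalty C A b s (Z s) / s"
        using s by (intro divide_right_mono) auto
      then show ?thesis using s by (simp add: diff_divide_distrib power2_eq_square)
    qed
    have "((\<lambda>s. b \<bullet> y - s * (y \<bullet> y) / 4) \<longlongrightarrow> b \<bullet> y - 0 * (y \<bullet> y) / 4) (at_right 0)"
      by (intro tendsto_intros) auto
    then have "eventually (\<lambda>s. a < b \<bullet> y - s * (y \<bullet> y) / 4) (at_right 0)"
      using y(2) by (intro order_tendstoD) auto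
    then show "eventually (\<lambda>s. a < penalty C A b s (Z s) / s) (at_right 0)"
      using pos by eventually_elim (use bound in force)
  next
    assume "p < a"
    then have "primal_value C A b < ereal a" using p by simp
    then obtain X where X: "X \<in> primal_space A b" "X \<in> psd_cone" "C \<bullet> X < a"
      unfolding primal_value_def INF_less_iff by auto
    obtain Y :: "real^'n^'n" where Y: "X = Y ** transpose Y" using psd_eq_gram[OF X(2)] by blast
    define K where "K = (\<Sum>i\<in>UNIV. \<Sum>j\<in>UNIV. Y $ i $ j ^ 6)"
    have bound: "penalty C A b s (Z s) / s \<le> C \<bullet> X + s * K" if s: "s > 0" for s
    proof -
      have "penalty C A b s (Z s) \<le> penalty C A b s Y" by (rule Z) fact
      also have "\<dots> = s * (C \<bullet> X) + s\<^sup>2 * K"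
        using X(1) by (simp add: penalty_def K_def primal_space_def flip: Y)
      finally have "penalty C A b s (Z s) / s \<le> (s * (C \<bullet> X) + s\<^sup>2 * K) / s"
        using s by (intro divide_right_mono) auto
      then show ?thesis using s by (simp add: add_divide_distrib power2_eq_square)
    qed
    have "((\<lambda>s. C \<bullet> X + s * K) \<longlongrightarrow> C \<bullet> X + 0 * K) (at_right 0)"
      by (intro tendsto_intros)
    then have "eventually (\<lambda>s. C \<bullet> X + s * K < a) (at_right 0)"
      using X(3) by (intro order_tendstoD) auto
    then show "eventually (\<lambda>s. penalty C A b s (Z s) / s < a) (at_right 0)"
      using pos by eventually_elim (use bound in force)
  }
qed

section \<open>The perturbed problems\<close>

text \<open>Either branch of the definition puts \<open>V\<close> at distance zero from the cone;
  the hypothesis enters the proof only in this form.\<close>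

lemma asymptotically_feasible_approx:
  assumes "asymptotically_feasible V" "0 < e"
  shows "\<exists>U X. U \<in> psd_cone \<and> X \<in> V \<and> norm (X - U) < e"
proof (cases "V \<inter> psd_cone = {}")
  case False
  then obtain X where "X \<in> V" "X \<in> psd_cone" by blast
  then show ?thesis using assms(2) by (intro exI[of _ X]) auto
next
  case True
  then have "0 \<in> closure {U - X | U X. U \<in> psd_cone \<and> X \<in> V}"
    using assms by (auto simp: asymptotically_feasible_def weakly_infeasible_def)
  then obtain D where "D \<in> {U - X | U X. U \<in> psd_cone \<and> X \<in> V}" "dist D 0 < e"
    using assms(2) unfolding closure_approachable by blast
  then show ?thesis by (auto simp: norm_minus_commute)
qed

text \<open>Writing X + e J = U + (e J + (X - U)), the positive definite
  \<open>e *\<^sub>R J\<close> absorbs the small discrepancy.\<close>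

lemma asymptotically_feasible_pos_def:
  assumes V: "asymptotically_feasible V" "V \<subseteq> sym_mats" and J: "pos_def J" and e: "0 < e"
  shows "\<exists>X\<in>V. pos_def (X + e *\<^sub>R J)"
proof -
  obtain d where d: "d > 0" "\<And>E. E \<in> sym_mats \<Longrightarrow> norm E < d \<Longrightarrow> pos_def (e *\<^sub>R J + E)"
    using pos_def_perturb[OF pos_def_scale[OF J e]] by blast
  obtain U X where UX: "U \<in> psd_cone" "X \<in> V" "norm (X - U) < d"
    using asymptotically_feasible_approx[OF V(1) d(1)] by blast
  then have "X - U \<in> sym_mats" using V(2) by (intro sym_mats_diff[OF _ psd_coneD(1)]) auto
  from pos_def_add_psd[OF d(2)[OF this UX(3)] UX(1)] UX(2) show ?thesis
    by (auto simp: algebra_simps)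
qed

section \<open>Perturbations as translations along \<open>Jp\<close> and \<open>Jd\<close>, and
  strict feasibility\<close>

lemma perturbed_primal_space_iff:
  assumes "J \<in> sym_mats"
  shows "X + h *\<^sub>R J \<in> primal_space A (perturbed_rhs A b J (e + h)) \<longleftrightarrow> X \<in> primal_space A (perturbed_rhs A b J e)"
proof -
  have "X + h *\<^sub>R J \<in> sym_mats \<longleftrightarrow> X \<in> sym_mats"
    using sym_mats_add[of X "h *\<^sub>R J"] sym_mats_diff[of "X + h *\<^sub>R J" "h *\<^sub>R J"] sym_mats_scale[OF assms, of h] by auto
  then show ?thesis by (auto simp: primal_space_def perturbed_rhs_def inner_add_right algebra_simps)
qed

lemma perturbed_rhs_0: "perturbed_rhs A b J 0 = b"
  by (simp add: perturbed_rhs_def vec_eq_iff)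

lemma perturbed_dual_slack:
  "dual_slack (perturbed_cost C J (e + h)) A y = dual_slack (perturbed_cost C J e) A y + h *\<^sub>R J"
  by (simp add: dual_slack_def perturbed_cost_def algebra_simps)

lemma perturbed_cost_0: "perturbed_cost C J 0 = C"
  by (simp add: perturbed_cost_def)

lemma perturbed_primal_strictly_feasible:
  assumes "asymptotically_feasible (primal_space A b)" "pos_def J" "0 < e"
  shows "\<exists>X\<in>primal_space A (perturbed_rhs A b J e). pos_def X"
proof -
  obtain X where "X \<in> primal_space A b" "pos_def (X + e *\<^sub>R J)"
    using asymptotically_feasible_pos_def[OF assms(1) _ assms(2,3)] by (auto simp: primal_space_def)
  then show ?thesis using perturbed_primal_space_iff[of J X e A b 0] assms(2)
    by (auto simp: pos_def_def perturbed_rhs_0)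
qed

lemma perturbed_dual_strictly_feasible:
  assumes "asymptotically_feasible (dual_space C A)" "pos_def J" "0 < e"
  shows "\<exists>y. pos_def (dual_slack (perturbed_cost C J e) A y)"
proof -
  obtain S where "S \<in> dual_space C A" "pos_def (S + e *\<^sub>R J)"
    using asymptotically_feasible_pos_def[OF assms(1) _ assms(2,3)] by (auto simp: dual_space_def)
  then show ?thesis using perturbed_dual_slack[of C J 0 e A] 
    by (auto simp: dual_space_def perturbed_cost_0)
qed

lemma convex_combination_less:
  fixes a b c :: real
  assumes "a < c" shows "\<exists>u. 0 < u \<and> u < 1 \<and> (1 - u) * a + u * b < c"
proof -
  have "((\<lambda>u. (1 - u) * a + u * b) \<longlongrightarrow> (1 - 0) * a + 0 * b) (at_right 0)"
    by (intro tendsto_intros)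
  then have "eventually (\<lambda>u. (1 - u) * a + u * b < c) (at_right 0)"
    using assms by (intro order_tendstoD) auto
  then have "eventually (\<lambda>u. (1 - u) * a + u * b < c \<and> u \<in> {0<..<1}) (at_right 0)"
    using eventually_at_right_real[of 0 1] by (auto intro: eventually_conj)
  then obtain u where "(1 - u) * a + u * b < c" "u \<in> {0<..<1}"
    using eventually_happens trivial_limit_at_right_real by blast
  then show ?thesis by auto
qed

text \<open>Mixing in a little of \<open>X0\<close> makes a nearly optimal matrix interior, so it
  survives small changes of the data.\<close>

lemma near_optimal_pos_def_primal:
  assumes X0: "X0 \<in> primal_space A b" "pos_def X0" and c: "primal_value C A b < ereal c"
  shows "\<exists>X\<in>primal_space A b. pos_def X \<and> C \<bullet> X < c"
proof -
  obtain X where X: "X \<in> primal_space A b" "X \<in> psd_cone" "C \<bullet> X < c"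
    using c unfolding primal_value_def INF_less_iff by auto
  obtain u where u: "0 < u" "u < 1" "(1 - u) * (C \<bullet> X) + u * (C \<bullet> X0) < c"
    using convex_combination_less[OF X(3)] by blast
  define Y where "Y = u *\<^sub>R X0 + (1 - u) *\<^sub>R X"
  have "Y \<in> primal_space A b"
    using X0 X by (auto simp: Y_def primal_space_def inner_add_right algebra_simps intro!: sym_mats_add sym_mats_scale sym_mats_diff)
  moreover have "pos_def Y" unfolding Y_def using X0 X u
    by (intro pos_def_add_psd pos_def_scale psd_scale) auto
  moreover have "C \<bullet> Y < c" using u by (simp add: Y_def inner_add_right)
  ultimately show ?thesis by blast
qed

lemma near_optimal_pos_def_dual:
  assumes y0: "pos_def (dual_slack C A y0)" and c: "ereal c < dual_value C A b"
  shows "\<exists>y. pos_def (dual_slack C A y) \<and> c < b \<bullet> y"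
proof -
  obtain x where x: "dual_slack C A x \<in> psd_cone" "c < b \<bullet> x"
    using c unfolding dual_value_def less_SUP_iff by auto
  then have "- (b \<bullet> x) < - c" by simp
  from convex_combination_less[OF this, of "- (b \<bullet> y0)"]
  obtain u where u: "0 < u" "u < 1" "(1 - u) * - (b \<bullet> x) + u * - (b \<bullet> y0) < - c" by blast
  define y where "y = u *\<^sub>R y0 + (1 - u) *\<^sub>R x"
  have "dual_slack C A y = u *\<^sub>R dual_slack C A y0 + (1 - u) *\<^sub>R dual_slack C A x"
    by (simp add: y_def dual_slack_def algebra_simps sum.distrib scaleR_sum_right sum_subtractf)
  moreover have "pos_def \<dots>" using y0 x u
    by (intro pos_def_add_psd pos_def_scale psd_scale) auto
  moreover have "c < b \<bullet> y" using u by (simp add: y_def inner_add_right)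
  ultimately show ?thesis by metis
qed

text \<open>At a minimiser of the penalty function every fifth power of an entry is a polynomial of degree
  at most three, so elimination applies to the minimal value; letting the penalty parameter tend to
  zero turns the relation for the minima into one for the optimal value.\<close>

lemma perturbed_value_algebraic:
  fixes C Jp Jd :: "real^'n^'n" and A :: "'m::finite \<Rightarrow> real^'n^'n"
  assumes primal: "\<And>t. t > 0 \<Longrightarrow>
      primal_value (perturbed_cost C Jd (t * \<alpha>)) A (perturbed_rhs A b Jp (t * \<beta>)) = ereal (V t)"
    and dual: "\<And>t. t > 0 \<Longrightarrow>
      dual_value (perturbed_cost C Jd (t * \<alpha>)) A (perturbed_rhs A b Jp (t * \<beta>)) = ereal (V t)"
  shows "\<exists>D g. (\<exists>j\<le>D::nat. g j \<noteq> 0) \<and> (\<forall>t>0. (\<Sum>j\<le>D. poly (g j) t * V t ^ j) = 0)"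
proof -
  define c where "c t = perturbed_cost C Jd (t * \<alpha>)" for t
  define r where "r t = perturbed_rhs A b Jp (t * \<beta>)" for t
  let ?T = "fst :: real \<times> real \<times> (real^'n^'n) \<Rightarrow> real"
  let ?S = "\<lambda>w :: real \<times> real \<times> (real^'n^'n). fst (snd w)"
  let ?Z = "\<lambda>w :: real \<times> real \<times> (real^'n^'n). snd (snd w)"
  let ?G = "\<lambda>w. ?Z w ** transpose (?Z w)"
  define dG where "dG k w = gram_deriv (?Z w) (axis (fst k) (axis (snd k) 1))" for k w
  define h where "h k w = - (?S w * (c (?T w) \<bullet> dG k w)
     + (\<Sum>l\<in>UNIV. 2 * (A l \<bullet> ?G w - r (?T w) $ l) * (A l \<bullet> dG k w)))" for k w
  \<comment> \<open>All critical points with positive \<open>s\<close>, not only minimisers: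
    elimination uses nothing but the equations.\<close>
  define W where "W = {w. ?S w > 0 \<and> (\<forall>k. 6 * (?S w)\<^sup>2 * ?Z w $ fst k $ snd k ^ 5 = h k w)}"
  define ev where "ev q w = poly (poly q [:?S w:]) (?T w)" for q :: "real poly poly" and w
  \<comment> \<open>The factor 6 s^2 of the fifth power in the critical equation, with
    \<open>s\<close> as outer variable.\<close>
  define \<sigma> :: "real poly poly" where "\<sigma> = [:0, 0, [:6:]:]"
  define z where "z w k = ?Z w $ fst k $ snd k" for w and k :: "'n \<times> 'n"
  interpret elimination W z ev \<sigma>
    by unfold_locales (simp_all add: ev_def)
  have ev_\<sigma>: "ev \<sigma> w = 6 * (?S w)\<^sup>2" for w
    by (simp add: ev_def \<sigma>_def power2_eq_square)
  have P_const: "zpoly d (\<lambda>w. x)" for d x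
    using zpoly_ev[of d "[:[:x:]:]"] by (simp add: ev_def[abs_def])
  have P_T: "zpoly d ?T" for d
    using zpoly_ev[of d "[:[:0, 1:]:]"] by (simp add: ev_def[abs_def])
  have P_S: "zpoly d ?S" for d
    using zpoly_ev[of d "[:0, 1:]"] by (simp add: ev_def[abs_def])
  have P_Z: "zpoly 1 (\<lambda>w. ?Z w $ i $ j)" for i j
    using zpoly_coord[of 1 "(i, j)"] by (simp add: z_def)
  have P_mult: "zpoly d (\<lambda>w. f w * g w)" if "zpoly d' f" "zpoly e g" "d' + e \<le> d" for d d' e f g
    using zpoly_mono[OF zpoly_mult[OF that(1,2)] that(3)] .
  have P_inner: "zpoly d (\<lambda>w. U w \<bullet> X w)"
    if "\<And>i j. zpoly 0 (\<lambda>w. U w $ i $ j)" "\<And>i j. zpoly d (\<lambda>w. X w $ i $ j)" 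
    for d and U X :: "_ \<Rightarrow> real^'n^'n"
    unfolding inner_vec_def by (auto intro!: zpoly_sum P_mult[of 0 _ d] that)
  have P_G: "zpoly 2 (\<lambda>w. ?G w $ i $ j)" for i j
    unfolding gram_eq by (auto intro!: zpoly_sum P_mult[OF P_Z P_Z])
  have P_dG: "zpoly 1 (\<lambda>w. dG k w $ i $ j)" for k i j
    unfolding dG_def gram_deriv_def matrix_matrix_mult_def transpose_def
    by (auto intro!: zpoly_sum zpoly.add P_mult[OF P_Z P_const] P_mult[OF P_const P_Z])
  have P_c: "zpoly 0 (\<lambda>w. c (?T w) $ i $ j)" for i j
    unfolding c_def perturbed_cost_def
    by (auto intro!: zpoly.add P_const P_mult[OF P_T[of 0]  P_const[of 0]] simp: mult.assoc)
  have P_r: "zpoly d (\<lambda>w. - r (?T w) $ l)" for l d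
  proof -
    have "zpoly d (\<lambda>w. - b $ l + ?T w * (- \<beta> * (A l \<bullet> Jp)))"
      by (intro zpoly.add P_const P_mult[OF P_T[of 0] P_const[of 0]]) simp
    then show ?thesis by (simp add: r_def perturbed_rhs_def algebra_simps)
  qed
  have P_res: "zpoly 2 (\<lambda>w. A l \<bullet> ?G w - r (?T w) $ l)" for l
    using zpoly.add[OF P_inner[OF P_const P_G] P_r] by simp
  have lead: "\<exists>f. zpoly 4 f \<and> (\<forall>w\<in>W. ev \<sigma> w * z w k ^ 5 = f w)" for k
  proof (intro exI conjI)
    show "zpoly 4 (\<lambda>w. (- 1) * (?S w * (c (?T w) \<bullet> dG k w)
     + (\<Sum>l\<in>UNIV. (2 * (A l \<bullet> ?G w - r (?T w) $ l)) * (A l \<bullet> dG k w))))"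
      by (rule P_mult[OF P_const[of 0] zpoly.add[where d = 4, OF
            P_mult[OF P_S[of 0] P_inner[OF P_c P_dG]]
            zpoly_sum[OF P_mult[OF P_mult[OF P_const[of 0] P_res, of 2] P_inner[OF P_const P_dG]]]]])
        simp_all
    show "\<forall>w\<in>W. ev \<sigma> w * z w k ^ 5 = (- 1) * (?S w * (c (?T w) \<bullet> dG k w)
     + (\<Sum>l\<in>UNIV. (2 * (A l \<bullet> ?G w - r (?T w) $ l)) * (A l \<bullet> dG k w)))"
      by (auto simp: W_def ev_\<sigma> z_def h_def)
  qed
  have nz: "ev \<sigma> w \<noteq> 0" if "w \<in> W" for w using that by (auto simp: W_def ev_\<sigma>)
  have pen: "zpoly 6 (\<lambda>w. penalty (c (?T w)) A (r (?T w)) (?S w) (?Z w))"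
  proof -
    have 1: "zpoly 6 (\<lambda>w. ?S w * (c (?T w) \<bullet> ?G w))"
      by (rule P_mult[OF P_S[of 0] P_inner[OF P_c P_G]]) simp
    have 2: "zpoly 6 (\<lambda>w. \<Sum>l\<in>UNIV. (A l \<bullet> ?G w - r (?T w) $ l)\<^sup>2)"
      unfolding power2_eq_square by (intro zpoly_sum P_mult[OF P_res P_res]) simp
    have 3: "zpoly 6 (\<lambda>w. (?S w)\<^sup>2 * (\<Sum>i\<in>UNIV. \<Sum>j\<in>UNIV. ?Z w $ i $ j ^ 6))"
      using zpoly_power[OF P_S[of 0], of 2] zpoly_power[OF P_Z, of 6]
      by (intro P_mult[of 0 _ 6] zpoly_sum) auto
    show ?thesis unfolding penalty_def by (intro zpoly.add 1 2 3)
  qed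
  obtain D l where Dl: "\<exists>j\<le>D. l j \<noteq> 0"
    "\<And>w. w \<in> W \<Longrightarrow> (\<Sum>j\<le>D. ev (l j) w * penalty (c (?T w)) A (r (?T w)) (?S w) (?Z w) ^ j) = 0"
    using algebraic_relation[OF lead nz pen] by blast
  define Z where "Z t s = (SOME Z. \<forall>Y. penalty (c t) A (r t) s Z \<le> penalty (c t) A (r t) s Y)" for t s
  have Z: "penalty (c t) A (r t) s (Z t s) \<le> penalty (c t) A (r t) s Y" if "s > 0" for t s Y
    using someI_ex[OF penalty_attains_min[OF that], of "c t" A "r t"] unfolding Z_def by blast
  define m where "m t s = penalty (c t) A (r t) s (Z t s) / s" for t s
  have "\<exists>g. (\<exists>j\<le>D. g j \<noteq> 0) \<and> (\<forall>t>0. (\<Sum>j\<le>D. poly (g j) t * V t ^ j) = 0)"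
  proof (rule algebraic_relation_limit)
    obtain j where "j \<le> D" "l j \<noteq> 0" using Dl(1) by blast
    \<comment> \<open>The relation concerns the minimum \<open>s * m t s\<close>; since
      \<open>[:0, 1:]\<close> is the variable s, the powers of s move into the coefficients.\<close>
    then show "\<exists>j\<le>D. l j * [:0, 1:] ^ j \<noteq> 0" by (intro exI[of _ j]) simp
    fix t s :: real assume "t > 0" "s > 0"
    define w where "w = (t, s, Z t s)"
    have "w \<in> W"
      using penalty_critical[OF Z[OF \<open>s > 0\<close>], of t] \<open>s > 0\<close>
      by (auto simp: W_def w_def h_def dG_def)
    from Dl(2)[OF this] have "0 = (\<Sum>j\<le>D. ev (l j) w * (s * m t s) ^ j)"
      using \<open>s > 0\<close> by (simp add: w_def m_def)
    also have "\<dots> = (\<Sum>j\<le>D. poly (poly (l j * [:0, 1:] ^ j) [:s:]) t * m t s ^ j)"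
      by (simp add: ev_def w_def power_mult_distrib mult.assoc)
    finally show "(\<Sum>j\<le>D. poly (poly (l j * [:0, 1:] ^ j) [:s:]) t * m t s ^ j) = 0" by simp
  next
    fix t :: real assume t: "t > 0"
    show "(m t \<longlongrightarrow> V t) (at_right 0)"
      unfolding m_def[abs_def]
      by (rule penalty_value_tendsto[OF primal[OF t, folded c_def r_def] dual[OF t, folded c_def r_def] Z])
  qed
  then show ?thesis by blast
qed

text \<open>Two semicontinuities from nearly optimal interior points at \<open>t0\<close>. A primal
  one is translated along \<open>Jp\<close> to follow the right-hand side; a dual \<open>y\<close>
  is kept, as only its slack moves.\<close>

lemma perturbed_value_continuous:
  fixes C Jp Jd :: "real^'n^'n" and A :: "'m::finite \<Rightarrow> real^'n^'n"
  assumes pf: "asymptotically_feasible (primal_space A b)" and df: "asymptotically_feasible (dual_space C A)"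
    and J: "pos_def Jp" "pos_def Jd" and pos: "\<alpha> > 0" "\<beta> > 0"
    and primal: "\<And>t. t > 0 \<Longrightarrow>
      primal_value (perturbed_cost C Jd (t * \<alpha>)) A (perturbed_rhs A b Jp (t * \<beta>)) = ereal (V t)"
    and dual: "\<And>t. t > 0 \<Longrightarrow>
      dual_value (perturbed_cost C Jd (t * \<alpha>)) A (perturbed_rhs A b Jp (t * \<beta>)) = ereal (V t)"
  shows "continuous_on {0<..} V"
proof (rule continuous_at_imp_continuous_on, rule ballI)
  fix t0 :: real assume "t0 \<in> {0<..}"
  then have t0: "t0 > 0" by simp
  have sym: "Jp \<in> sym_mats" "Jd \<in> sym_mats" using J by (auto simp: pos_def_def)
  define c where "c t = perturbed_cost C Jd (t * \<alpha>)" for t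
  define r where "r t = perturbed_rhs A b Jp (t * \<beta>)" for t
  have c_cont: "(c \<longlongrightarrow> c t0) (at t0)"
    unfolding c_def[abs_def] perturbed_cost_def by (intro tendsto_intros)
  have r_cont: "(r \<longlongrightarrow> r t0) (at t0)"
    unfolding r_def[abs_def] perturbed_rhs_def by (intro tendsto_intros tendsto_vec_lambda)
  have near: "eventually (\<lambda>t. 0 < t) (at t0)"
    using order_tendstoD(1)[OF tendsto_ident_at t0] .
  have pd_near: "eventually (\<lambda>t. U + (t - t0) *\<^sub>R J \<in> psd_cone) (at t0)"
    if U: "pos_def U" and J: "J \<in> sym_mats" for U J :: "real^'n^'n"
  proof -
    obtain d where d: "d > 0" "\<And>E. E \<in> sym_mats \<Longrightarrow> norm E < d \<Longrightarrow> pos_def (U + E)"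
      using pos_def_perturb[OF U] by blast
    have "((\<lambda>t. norm ((t - t0) *\<^sub>R J)) \<longlongrightarrow> norm ((t0 - t0) *\<^sub>R J)) (at t0)"
      by (intro tendsto_intros)
    then have "eventually (\<lambda>t. norm ((t - t0) *\<^sub>R J) < d) (at t0)"
      using d(1) by (intro order_tendstoD) auto
    then show ?thesis by eventually_elim (intro pos_def_psd d(2) sym_mats_scale J)
  qed
  show "isCont V t0"
    unfolding isCont_def
  proof (rule order_tendstoI)
    fix a assume "V t0 < a"
    moreover obtain X0 where "X0 \<in> primal_space A (r t0)" "pos_def X0"
      using perturbed_primal_strictly_feasible[OF pf J(1), of "t0 * \<beta>"] t0 pos by (auto simp: r_def)
    ultimately obtain X where X: "X \<in> primal_space A (r t0)" "pos_def X" "c t0 \<bullet> X < a"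
      using near_optimal_pos_def_primal[of X0 A "r t0" "c t0" a] primal[OF t0]
      by (auto simp: c_def r_def)
    define Y where "Y t = X + (t - t0) *\<^sub>R (\<beta> *\<^sub>R Jp)" for t
    have Y: "Y t \<in> primal_space A (r t)" for t
      using X(1) perturbed_primal_space_iff[OF sym(1), of X "(t - t0) * \<beta>" A b "t0 * \<beta>"]
      by (simp add: Y_def r_def algebra_simps)
    have "((\<lambda>t. c t \<bullet> Y t) \<longlongrightarrow> c t0 \<bullet> Y t0) (at t0)"
      unfolding Y_def by (intro tendsto_intros c_cont)
    then have "eventually (\<lambda>t. c t \<bullet> Y t < a) (at t0)"
      using X(3) by (intro order_tendstoD) (auto simp: Y_def)
    then show "eventually (\<lambda>t. V t < a) (at t0)"
      using near pd_near[OF X(2) sym_mats_scale[OF sym(1), of \<beta>]]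
    proof eventually_elim
      case (elim t)
      then have "primal_value (c t) A (r t) \<le> ereal (c t \<bullet> Y t)"
        unfolding primal_value_def using Y[of t] by (intro INF_lower) (auto simp: Y_def)
      with primal[OF elim(2)] elim(1) show ?case by (simp add: c_def r_def)
    qed
  next
    fix a assume "a < V t0"
    moreover obtain y0 where "pos_def (dual_slack (c t0) A y0)"
      using perturbed_dual_strictly_feasible[OF df J(2), of "t0 * \<alpha>"] t0 pos by (auto simp: c_def)
    ultimately obtain y where y: "pos_def (dual_slack (c t0) A y)" "a < r t0 \<bullet> y"
      using near_optimal_pos_def_dual[of "c t0" A y0 a "r t0"] dual[OF t0]
      by (auto simp: c_def r_def)
    have slack: "dual_slack (c t) A y = dual_slack (c t0) A y + (t - t0) *\<^sub>R (\<alpha> *\<^sub>R Jd)" for t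
      using perturbed_dual_slack[of C Jd "t0 * \<alpha>" "(t - t0) * \<alpha>" A y]
      by (simp add: c_def algebra_simps)
    have "((\<lambda>t. r t \<bullet> y) \<longlongrightarrow> r t0 \<bullet> y) (at t0)"
      by (intro tendsto_intros r_cont)
    then have "eventually (\<lambda>t. a < r t \<bullet> y) (at t0)"
      using y(2) by (intro order_tendstoD) auto
    then show "eventually (\<lambda>t. a < V t) (at t0)"
      using near pd_near[OF y(1) sym_mats_scale[OF sym(2), of \<alpha>]]
    proof eventually_elim
      case (elim t)
      then have "ereal (r t \<bullet> y) \<le> dual_value (c t) A (r t)"
        unfolding dual_value_def using slack[of t] by (intro SUP_upper) simp
      with dual[OF elim(2)] elim(1) show ?case by (simp add: c_def r_def)
    qed
  qed
qed

section \<open>Monotone limits and duality for the perturbed pair\<close>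

lemma mono_limit_at_right:
  fixes v :: "real \<Rightarrow> ereal"
  assumes "\<And>s t. 0 < s \<Longrightarrow> s \<le> t \<Longrightarrow> v s \<le> v t"
  shows "(v \<longlongrightarrow> (INF t\<in>{0<..}. v t)) (at_right 0)"
proof (rule order_tendstoI)
  fix a assume a: "a < (INF t\<in>{0<..}. v t)"
  have "a < v t" if "t > 0" for t
    using a by (rule less_le_trans) (use that in \<open>auto intro: INF_lower\<close>)
  then show "eventually (\<lambda>t. a < v t) (at_right 0)"
    by (auto simp: eventually_at_right_field intro: exI[of _ 1])
next
  fix a assume "(INF t\<in>{0<..}. v t) < a"
  then obtain t where t: "t > 0" "v t < a" unfolding INF_less_iff by auto
  then have "v s < a" if "0 < s" "s < t" for s using assms[of s t] that by auto
  with t(1) show "eventually (\<lambda>t. v t < a) (at_right 0)"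
    by (auto simp: eventually_at_right_field)
qed

text \<open>A positive \<epsilon> makes the dual strictly feasible, a positive \<eta> the primal,
  and strictness on one side is enough; hence both duality theorems.\<close>

lemma perturbed_strong_duality:
  fixes C Jp Jd :: "real^'n^'n" and A :: "'m::finite \<Rightarrow> real^'n^'n"
  assumes sym: "C \<in> sym_mats" "\<And>i. A i \<in> sym_mats"
    and J: "pos_def Jp" "pos_def Jd"
    and feas: "asymptotically_pd_feasible C A b"
    and e: "\<epsilon> > 0 \<or> \<eta> > 0"
  shows "primal_value (perturbed_cost C Jd \<epsilon>) A (perturbed_rhs A b Jp \<eta>)
       = dual_value (perturbed_cost C Jd \<epsilon>) A (perturbed_rhs A b Jp \<eta>)"
proof -
  have c: "perturbed_cost C Jd \<epsilon> \<in> sym_mats"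
    unfolding perturbed_cost_def using sym J by (auto simp: pos_def_def intro!: sym_mats_add sym_mats_scale)
  have pf: "asymptotically_feasible (primal_space A b)" and df: "asymptotically_feasible (dual_space C A)"
    using feas by (auto simp: asymptotically_pd_feasible_def)
  from e show ?thesis
  proof
    assume "\<epsilon> > 0"
    then obtain y where "pos_def (dual_slack (perturbed_cost C Jd \<epsilon>) A y)"
      using perturbed_dual_strictly_feasible[OF df J(2)] by blast
    then show ?thesis by (rule strong_duality_dual_strict[OF c sym(2)])
  next
    assume "\<eta> > 0"
    then obtain X where "X \<in> primal_space A (perturbed_rhs A b Jp \<eta>)" "pos_def X"
      using perturbed_primal_strictly_feasible[OF pf J(1)] by blast
    then show ?thesis by (rule strong_duality_primal_strict[OF c sym(2)])
  qed
qed

lemma primal_value_mono_cost: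
  assumes J: "pos_def J" and "e \<le> e'"
  shows "primal_value (perturbed_cost C J e) A b \<le> primal_value (perturbed_cost C J e') A b"
  unfolding primal_value_def
proof (rule INF_mono, rule bexI)
  fix X assume X: "X \<in> primal_space A b \<inter> psd_cone"
  have "0 \<le> J \<bullet> X" using X pos_def_psd[OF J] by (intro psd_inner_nonneg) auto
  then have "e * (J \<bullet> X) \<le> e' * (J \<bullet> X)" using assms(2) by (intro mult_right_mono)
  then show "ereal (perturbed_cost C J e \<bullet> X) \<le> ereal (perturbed_cost C J e' \<bullet> X)"
    by (simp add: perturbed_cost_def inner_add_left)
qed

lemma perturbed_rhs_inner:
  "perturbed_rhs A b J e \<bullet> y = b \<bullet> y - e * (dual_slack C A y \<bullet> J) + e * (C \<bullet> J)"
  by (simp add: perturbed_rhs_def dual_slack_inner inner_vec_def[of _ y] sum.distrib sum_distrib_left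
      algebra_simps)

text \<open>Up to the linear term \<open>t * \<beta> * (C \<bullet> J)\<close> the value is antitone in \<open>t\<close>, because the objective
  at a feasible \<open>y\<close> loses \<open>t * \<beta>\<close> times the nonnegative product of its slack with \<open>J\<close>.\<close>

lemma dual_value_perturbed_rhs_limit:
  assumes J: "pos_def J" and \<beta>: "0 \<le> \<beta>"
  shows "\<exists>L. ((\<lambda>t. dual_value C A (perturbed_rhs A b J (t * \<beta>))) \<longlongrightarrow> L) (at_right 0)"
proof (cases "{y. dual_slack C A y \<in> psd_cone} = {}")
  case True
  \<comment> \<open>With no feasible \<open>y\<close> the value is constantly minus
    infinity.\<close>
  then show ?thesis unfolding dual_value_def by auto
next
  case False
  define u where "u t = (SUP y\<in>{y. dual_slack C A y \<in> psd_cone}.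
    ereal (b \<bullet> y - t * \<beta> * (dual_slack C A y \<bullet> J)))" for t
  have val: "dual_value C A (perturbed_rhs A b J (t * \<beta>)) = u t + ereal (t * \<beta> * (C \<bullet> J))" for t
    unfolding dual_value_def u_def perturbed_rhs_inner[of A b J _ _ C] plus_ereal.simps(1)[symmetric]
    by (rule SUP_ereal_add_left[OF False]) simp
  have "u t \<le> u s" if "s \<le> t" for s t
    unfolding u_def
  proof (rule SUP_mono, rule bexI)
    fix y assume y: "y \<in> {y. dual_slack C A y \<in> psd_cone}"
    then have "0 \<le> dual_slack C A y \<bullet> J" using pos_def_psd[OF J] by (intro psd_inner_nonneg) auto
    then have "s * \<beta> * (dual_slack C A y \<bullet> J) \<le> t * \<beta> * (dual_slack C A y \<bullet> J)"
      using that \<beta> by (intro mult_right_mono)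
    then show "ereal (b \<bullet> y - t * \<beta> * (dual_slack C A y \<bullet> J)) \<le> ereal (b \<bullet> y - s * \<beta> * (dual_slack C A y \<bullet> J))"
      by simp
  qed
  then obtain L where "((\<lambda>t. - u t) \<longlongrightarrow> L) (at_right 0)"
    using mono_limit_at_right[of "\<lambda>t. - u t"] by auto
  from tendsto_uminus_ereal[OF this] have "(u \<longlongrightarrow> - L) (at_right 0)" by simp
  moreover have "((\<lambda>t. ereal (t * \<beta> * (C \<bullet> J))) \<longlongrightarrow> ereal (0 * \<beta> * (C \<bullet> J))) (at_right 0)"
    by (intro tendsto_intros)
  \<comment> \<open>The linear term has a finite limit, so the sum of limits is meaningful even if
    \<open>u\<close> diverges.\<close>
  ultimately show ?thesis unfolding val
    by (intro exI) (rule tendsto_add_ereal_general, auto)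
qed

theorem theorem1:
  fixes C Jp Jd :: "real^'n^'n"
    and A :: "'m::finite \<Rightarrow> real^'n^'n"
    and b :: "real^'m"
    and \<alpha> \<beta> :: real
  assumes "C \<in> sym_mats" and "\<And>i. A i \<in> sym_mats"
    and "pos_def Jp" and "pos_def Jd"
    and "asymptotically_pd_feasible C A b"
    and "\<alpha> \<ge> 0" and "\<beta> \<ge> 0" and "(\<alpha>, \<beta>) \<noteq> (0, 0)"
  shows "\<exists>(v :: real \<Rightarrow> ereal) L.
           (\<forall>t>0. common_value C A b Jp Jd (t * \<alpha>) (t * \<beta>) = Some (v t)) \<and>
           (v \<longlongrightarrow> L) (at_right 0)"
proof -
  define p where "p t = primal_value (perturbed_cost C Jd (t * \<alpha>)) A (perturbed_rhs A b Jp (t * \<beta>))" for t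
  define d where "d t = dual_value (perturbed_cost C Jd (t * \<alpha>)) A (perturbed_rhs A b Jp (t * \<beta>))" for t
  have pd: "p t = d t" if "t > 0" for t
    unfolding p_def d_def
    by (rule perturbed_strong_duality) (use assms that in \<open>auto simp: less_le\<close>)
  then have val: "common_value C A b Jp Jd (t * \<alpha>) (t * \<beta>) = Some (p t)" if "t > 0" for t
    using that by (simp add: common_value_def p_def d_def)
  have pf: "asymptotically_feasible (primal_space A b)" and df: "asymptotically_feasible (dual_space C A)"
    using assms(5) by (auto simp: asymptotically_pd_feasible_def)
  \<comment> \<open>For \<open>\<beta> = 0\<close> the primal feasible set is fixed, for
    \<open>\<alpha> = 0\<close> the dual one; monotonicity is visible on that side.\<close>
  consider "\<beta> = 0" | "\<alpha> = 0" | "\<alpha> > 0" "\<beta> > 0" using assms by fastforce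
  then have "\<exists>L. (p \<longlongrightarrow> L) (at_right 0)"
  proof cases
    case 1
    have "p s \<le> p t" if "0 < s" "s \<le> t" for s t
      using primal_value_mono_cost[OF assms(4) mult_right_mono[OF that(2) assms(6)]] 1 by (simp add: p_def)
    then show ?thesis using mono_limit_at_right by blast
  next
    case 2
    then obtain L where "(d \<longlongrightarrow> L) (at_right 0)"
      using dual_value_perturbed_rhs_limit[OF assms(3,7), of C A b]
      by (auto simp: d_def[abs_def] perturbed_cost_0)
    moreover have "eventually (\<lambda>t. d t = p t) (at_right 0)"
      using eventually_at_right_less[of 0] by eventually_elim (simp add: pd)
    ultimately have "(p \<longlongrightarrow> L) (at_right 0)" by (rule Lim_transform_eventually)
    then show ?thesis by blast
  next
    case 3
    \<comment> \<open>Feasible points on both sides bound the common value from above and from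
      below.\<close>
    have fin: "\<bar>p t\<bar> \<noteq> \<infinity>" if t: "t > 0" for t
    proof -
      obtain X where "X \<in> primal_space A (perturbed_rhs A b Jp (t * \<beta>))" "pos_def X"
        using perturbed_primal_strictly_feasible[OF pf assms(3), of "t * \<beta>"] t 3 by auto
      then have "p t \<le> ereal (perturbed_cost C Jd (t * \<alpha>) \<bullet> X)"
        unfolding p_def primal_value_def by (intro INF_lower) (auto intro: pos_def_psd)
      moreover obtain y where "pos_def (dual_slack (perturbed_cost C Jd (t * \<alpha>)) A y)"
        using perturbed_dual_strictly_feasible[OF df assms(4), of "t * \<alpha>"] t 3 by auto
      then have "ereal (perturbed_rhs A b Jp (t * \<beta>) \<bullet> y) \<le> d t"
        unfolding d_def dual_value_def by (intro SUP_upper) (auto intro: pos_def_psd)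
      ultimately show ?thesis using pd[OF t] by auto
    qed
    define V where "V t = real_of_ereal (p t)" for t
    have V: "p t = ereal (V t)" "d t = ereal (V t)" if "t > 0" for t
      using fin[OF that] pd[OF that] by (auto simp: V_def ereal_real)
    obtain D g where "\<exists>j\<le>D. g j \<noteq> 0" "\<And>t. t > 0 \<Longrightarrow> (\<Sum>j\<le>D. poly (g j) t * V t ^ j) = 0"
      using perturbed_value_algebraic[OF V[unfolded p_def d_def]] by blast
    then obtain F where "finite F" "\<And>c. c \<notin> F \<Longrightarrow> finite {t. 0 < t \<and> V t = c}"
      using finite_fibres_of_algebraic[of D g V] by blast
    moreover have "continuous_on {0<..} V"
      by (rule perturbed_value_continuous[OF pf df assms(3,4) 3 V[unfolded p_def d_def]])
    ultimately obtain L where "((\<lambda>t. ereal (V t)) \<longlongrightarrow> L) (at_right 0)"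
      using limit_at_right_if_finite_fibres[of V F] by blast
    moreover have "eventually (\<lambda>t. ereal (V t) = p t) (at_right 0)"
      using eventually_at_right_less[of 0] by eventually_elim (simp add: V)
    ultimately have "(p \<longlongrightarrow> L) (at_right 0)" by (rule Lim_transform_eventually)
    then show ?thesis by blast
  qed
  with val show ?thesis by blast
qed

end
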